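(* Let $n\ge 1$ be an integer and let $A_1,\dots,A_n\in C_p$ for some real $p>0$, such that $\sum_{i=1}^n A_i=0$. Then, for each choice of the sign $\pm$ (the same sign in all terms of the sum): if $0<p\le 2$, $$\sum_{i,j=1}^n\|A_i\pm A_j\|_p^2\le 2n^{2/p}\sum_{i=1}^n\|A_i\|_p^2;$$ and if $2\le p<\infty$, $$2n^{2/p}\sum_{i=1}^n\|A_i\|_p^2\le \sum_{i,j=1}^n\|A_i\pm A_j\|_p^2.$$ In particular, in the case $p=2$, $\sum_{i,j=1}^n\|A_i-A_j\|_2^2=2n\sum_{i=1}^n\|A_i\|_2^2$.
   Context: $\mathcal{H}$ is a separable complex Hilbert space and $B(\mathcal{H})$ is the algebra of all bounded linear operators on $\mathcal{H}$. For $A\in B(\mathcal{H})$, $|A|=(A^*A)^{1/2}$. For a compact operator $A\in B(\mathcal{H})$ and $0<p<\infty$, the Schatten $p$-norm (only a quasi-norm when $0<p<1$) is $\|A\|_p=(\operatorname{tr}|A|^p)^{1/p}$, where $\operatorname{tr}$ is the usual trace. The Schatten $p$-class $C_p$ is the set of compact operators $A\in B(\mathcal{H})$ with $\|A\|_p<\infty$; it is a two-sided ideal of $B(\mathcal{H})$. *)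

theory Defs
  imports "HOL-Analysis.Analysis"
begin

section \<open>Complex Hilbert spaces\<close>

text \<open>
  The real structure (norm, topology, real inner product) is the one of \<^class>\<open>real_inner\<close>;
  it is the realification of the complex structure, so the norm of \<open>x\<close> is the square root of
  \<open>cinner x x\<close>. The complex inner product is linear in its first argument.
\<close>

class complex_inner_space = real_inner +
  fixes scaleC :: "complex \<Rightarrow> 'a \<Rightarrow> 'a"  (infixr \<open>*\<^sub>C\<close> 75)
    and cinner :: "'a \<Rightarrow> 'a \<Rightarrow> complex"
  assumes scaleC_add_right: "c *\<^sub>C (x + y) = c *\<^sub>C x + c *\<^sub>C y"
    and scaleC_add_left: "(c + d) *\<^sub>C x = c *\<^sub>C x + d *\<^sub>C x"
    and scaleC_scaleC: "c *\<^sub>C (d *\<^sub>C x) = (c * d) *\<^sub>C x"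
    and scaleC_of_real: "complex_of_real r *\<^sub>C x = r *\<^sub>R x"
    and cinner_add_left: "cinner (x + y) z = cinner x z + cinner y z"
    and cinner_scaleC_left: "cinner (c *\<^sub>C x) y = c * cinner x y"
    and cinner_commute: "cinner x y = cnj (cinner y x)"
    and inner_eq_Re_cinner: "inner x y = Re (cinner x y)"

class complex_hilbert_space = complex_inner_space + complete_space

instantiation complex :: complex_hilbert_space
begin

definition scaleC_complex :: "complex \<Rightarrow> complex \<Rightarrow> complex"
  where "scaleC_complex c x = c * x"

definition cinner_complex :: "complex \<Rightarrow> complex \<Rightarrow> complex"
  where "cinner_complex x y = x * cnj y"

instance
  by standard
    (auto simp: scaleC_complex_def cinner_complex_def algebra_simps scaleR_conv_of_real
      inner_complex_def)

end

text \<open>Orthonormal bases are maximal orthonormal sets.\<close>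

definition orthonormal_basis :: "'a::complex_hilbert_space set \<Rightarrow> bool"
  where "orthonormal_basis B \<longleftrightarrow>
    (\<forall>e\<in>B. norm e = 1) \<and>
    (\<forall>e\<in>B. \<forall>f\<in>B. e \<noteq> f \<longrightarrow> cinner e f = 0) \<and>
    (\<forall>x. (\<forall>e\<in>B. cinner x e = 0) \<longrightarrow> x = 0)"


section \<open>Bounded, positive and compact operators\<close>

text \<open>
  The type \<^typ>\<open>'a \<Rightarrow>\<^sub>L 'a\<close> consists of the bounded real-linear maps; the algebra of bounded
  complex-linear operators is the following subset.
\<close>

definition bounded_operators :: "('a::complex_hilbert_space \<Rightarrow>\<^sub>L 'a) set"
  where "bounded_operators = {A. \<forall>c x. blinfun_apply A (c *\<^sub>C x) = c *\<^sub>C blinfun_apply A x}"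

definition adjoint_op :: "('a::complex_hilbert_space \<Rightarrow>\<^sub>L 'a) \<Rightarrow> 'a \<Rightarrow>\<^sub>L 'a"
  where "adjoint_op A = (THE B. B \<in> bounded_operators \<and>
    (\<forall>x y. cinner (blinfun_apply A x) y = cinner x (blinfun_apply B y)))"

definition positive_op :: "('a::complex_hilbert_space \<Rightarrow>\<^sub>L 'a) \<Rightarrow> bool"
  where "positive_op T \<longleftrightarrow> T \<in> bounded_operators \<and>
    (\<forall>x. cinner (blinfun_apply T x) x \<in> \<real>\<^sub>\<ge>\<^sub>0)"

definition compact_op :: "('a::complex_hilbert_space \<Rightarrow>\<^sub>L 'a) \<Rightarrow> bool"
  where "compact_op T \<longleftrightarrow> T \<in> bounded_operators \<and>
    compact (closure (blinfun_apply T ` cball 0 1))"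

text \<open>\<open>abs_op A\<close> is the operator \<open>|A|\<close>, the unique positive square root of \<open>A\<^sup>* A\<close>.\<close>

definition abs_op :: "('a::complex_hilbert_space \<Rightarrow>\<^sub>L 'a) \<Rightarrow> 'a \<Rightarrow>\<^sub>L 'a"
  where "abs_op A = (THE S. positive_op S \<and> S o\<^sub>L S = adjoint_op A o\<^sub>L A)"

text \<open>
  The power \<open>T\<^sup>p\<close> of a compact positive operator \<open>T\<close>, for \<open>p > 0\<close>. By the spectral theorem the
  eigenvectors of \<open>T\<close> span a dense subspace, so the functional calculus is determined by its
  action on them. The case \<open>t = 0\<close> says that \<open>T\<^sup>p\<close> vanishes on the kernel of \<open>T\<close>, as
  \<open>0 powr p = 0\<close>. The value is meaningful only for compact positive \<open>T\<close>.
\<close>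

definition op_powr :: "('a::complex_hilbert_space \<Rightarrow>\<^sub>L 'a) \<Rightarrow> real \<Rightarrow> 'a \<Rightarrow>\<^sub>L 'a"
  where "op_powr T p = (THE S. S \<in> bounded_operators \<and>
    (\<forall>t\<ge>0. \<forall>x. blinfun_apply T x = t *\<^sub>R x \<longrightarrow> blinfun_apply S x = (t powr p) *\<^sub>R x))"

text \<open>
  The trace of a positive operator, with values in \<open>[0, \<infinity>]\<close>. The choice of the orthonormal basis
  is immaterial.
\<close>

definition trace_op :: "('a::complex_hilbert_space \<Rightarrow>\<^sub>L 'a) \<Rightarrow> ennreal"
  where "trace_op T =
    (\<Sum>\<^sub>\<infinity>e\<in>(SOME B. orthonormal_basis B). ennreal (Re (cinner (blinfun_apply T e) e)))"


section \<open>Schatten classes\<close>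

text \<open>
  The Schatten norm of a compact operator takes values in \<open>[0, \<infinity>]\<close>; the conditional extends the
  root \<open>t \<mapsto> t powr (1 / p)\<close> to \<open>t = \<infinity>\<close>.
\<close>

definition schatten_norm :: "real \<Rightarrow> ('a::complex_hilbert_space \<Rightarrow>\<^sub>L 'a) \<Rightarrow> ennreal"
  where "schatten_norm p A =
    (let t = trace_op (op_powr (abs_op A) p)
     in if t = \<infinity> then \<infinity> else ennreal (enn2real t powr (1 / p)))"

definition schatten_class :: "real \<Rightarrow> ('a::complex_hilbert_space \<Rightarrow>\<^sub>L 'a) set"
  where "schatten_class p = {A. compact_op A \<and> schatten_norm p A < \<infinity>}"

end

theory Submission
  imports Defs
begin

text \<open>
  Put \<open>q = p / 2\<close>. The number \<open>\<parallel>A\<parallel>\<^sub>p\<^sup>2\<close> is the \<open>q\<close>-(quasi)norm of the eigenvalues of the positive operator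
  \<open>A\<^sup>* A\<close>, and \<open>(\<Sum>i. A i) = 0\<close> gives \<open>(\<Sum>i j. \<bar>A i \<plusminus> A j\<bar>\<^sup>2) = 2 n (\<Sum>i. \<bar>A i\<bar>\<^sup>2)\<close>. For \<open>q \<ge> 1\<close> the triangle
  inequality bounds the norm of the left-hand side by \<open>\<Sum>i j. \<parallel>A i \<plusminus> A j\<parallel>\<^sub>p\<^sup>2\<close>, while superadditivity of
  \<open>X \<mapsto> tr X\<^sup>q\<close> on positive operators (McCarthy) and the power mean inequality bound that of the
  right-hand side from below; for \<open>q \<le> 1\<close> all three inequalities are reversed.

  Both trace inequalities compare sequences of numbers: the diagonal of \<open>T\<close> in an orthonormal basis
  arises from the eigenvalues of \<open>T\<close>, and the eigenvalues of the summands \<open>X i\<close> arise from those of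
  \<open>\<Sum>i. X i\<close>, by applying a substochastic matrix. The former reduces the triangle inequality to
  Minkowski's inequality for the diagonals in an eigenbasis of the sum.
\<close>

section \<open>Sums of non-negative numbers\<close>

text \<open>The obstacle is that the summands \<open>X i\<close> do not commute with their sum X, so
  eigenvalues cannot be compared termwise. The substochastic matrix for the summands comes from the
  operators X_i^(1/2) X^(-1/2), the inverse being taken off the kernel of X: between an eigenvector
  g of X_i (eigenvalue l) and e of X (eigenvalue m) the squared modulus of the entry is l |<g, e>|^2
  / m. As X_i is at most X, each of these operators is a contraction, which bounds the rows by 1.
  The X^(-1/2) X_i X^(-1/2) add up to the projection off the kernel, so the columns with m > 0 sum
  to exactly 1; the case q <= 1 needs this lower bound. Only the weights appear below, not the
  operators behind them.

  The constant has two sources: the expansion of the squares gives 2 n, and the power mean of n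
  numbers gives n^(1/q - 1) after taking q-th roots; with 1/q = 2/p the product is 2 n^(2/p).

  Sums over bases are taken in [0, \<infinity>], where they always exist and can be interchanged;
  powers are applied to real numbers only.\<close>

lemma summable_on_ennreal_any: "(f :: 'a \<Rightarrow> ennreal) summable_on A"
  by (rule nonneg_summable_on_complete) simp

lemma infsum_ennreal_SUP:
  fixes f :: "'a \<Rightarrow> ennreal"
  shows "infsum f A = (SUP F\<in>{F. finite F \<and> F \<subseteq> A}. sum f F)"
  by (rule nonneg_infsum_complete) simp

lemma finite_sum_le_infsum_ennreal:
  fixes f :: "'a \<Rightarrow> ennreal"
  assumes "finite F" "F \<subseteq> A"
  shows "sum f F \<le> infsum f A"
  unfolding infsum_ennreal_SUP using assms by (intro SUP_upper) auto

lemma infsum_mono_ennreal: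
  fixes f g :: "'a \<Rightarrow> ennreal"
  assumes "\<And>x. x \<in> A \<Longrightarrow> f x \<le> g x"
  shows "infsum f A \<le> infsum g A"
  using assms by (intro infsum_mono summable_on_ennreal_any)

lemma infsum_cmult_right_ennreal:
  fixes f :: "'a \<Rightarrow> ennreal"
  shows "infsum (\<lambda>x. c * f x) A = c * infsum f A"
  unfolding infsum_ennreal_SUP sum_distrib_left[symmetric]
  by (rule SUP_mult_left_ennreal[symmetric])

lemma infsum_sum_ennreal:
  fixes f :: "'i \<Rightarrow> 'a \<Rightarrow> ennreal"
  assumes "finite I"
  shows "infsum (\<lambda>x. \<Sum>i\<in>I. f i x) A = (\<Sum>i\<in>I. infsum (f i) A)"
  using assms by (induction rule: finite_induct) (simp_all add: infsum_add summable_on_ennreal_any)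

text \<open>By symmetry one inequality suffices. A finite part of the outer sum can be moved inside,
  where it is at most the full sum.\<close>

lemma infsum_swap_ennreal:
  fixes f :: "'a \<Rightarrow> 'b \<Rightarrow> ennreal"
  shows "infsum (\<lambda>x. infsum (f x) B) A = infsum (\<lambda>y. infsum (\<lambda>x. f x y) A) B"
proof -
  have le: "infsum (\<lambda>x. infsum (f x) B) A \<le> infsum (\<lambda>y. infsum (\<lambda>x. f x y) A) B"
    for f :: "'c \<Rightarrow> 'd \<Rightarrow> ennreal" and A B
  proof (rule infsum_le_finite_sums[OF summable_on_ennreal_any])
    fix F assume F: "finite F" "F \<subseteq> A"
    have "(\<Sum>x\<in>F. infsum (f x) B) = infsum (\<lambda>y. \<Sum>x\<in>F. f x y) B"
      using F(1) by (simp add: infsum_sum_ennreal)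
    also have "\<dots> \<le> infsum (\<lambda>y. infsum (\<lambda>x. f x y) A) B"
      using F by (intro infsum_mono_ennreal finite_sum_le_infsum_ennreal)
    finally show "(\<Sum>x\<in>F. infsum (f x) B) \<le> \<dots>" .
  qed
  show ?thesis
    using le[of f B A] le[of "\<lambda>y x. f x y" A B] by (rule antisym)
qed

lemma infsum_ennreal_has_sum:
  fixes f :: "'a \<Rightarrow> real"
  assumes "(f has_sum s) A" "\<And>x. x \<in> A \<Longrightarrow> f x \<ge> 0"
  shows "infsum (\<lambda>x. ennreal (f x)) A = ennreal s"
proof -
  have "ennreal s = (SUP F\<in>{F. finite F \<and> F \<subseteq> A}. ennreal (sum f F))"
    using infsum_nonneg_is_SUPREMUM_ennreal[of f A] assms by (auto simp: has_sum_iff)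
  also have "\<dots> = (SUP F\<in>{F. finite F \<and> F \<subseteq> A}. \<Sum>x\<in>F. ennreal (f x))"
    using assms(2) by (intro SUP_cong refl) (auto intro!: sum_ennreal[symmetric])
  finally show ?thesis
    by (simp add: infsum_ennreal_SUP)
qed

lemma infsum_le_ennreal:
  fixes f :: "'a \<Rightarrow> real"
  assumes "\<And>F. finite F \<Longrightarrow> F \<subseteq> A \<Longrightarrow> sum f F \<le> s" "\<And>x. x \<in> A \<Longrightarrow> f x \<ge> 0"
  shows "infsum (\<lambda>x. ennreal (f x)) A \<le> ennreal s"
proof (rule infsum_le_finite_sums[OF summable_on_ennreal_any])
  fix F assume F: "finite F" "F \<subseteq> A"
  then have "(\<Sum>x\<in>F. ennreal (f x)) = ennreal (sum f F)"
    using assms(2) by (intro sum_ennreal) auto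
  then show "(\<Sum>x\<in>F. ennreal (f x)) \<le> ennreal s"
    using assms(1)[OF F] by (simp add: ennreal_leI)
qed

lemma infsum_Sigma_finite_ennreal:
  fixes f :: "'i \<times> 'a \<Rightarrow> ennreal"
  assumes "finite I"
  shows "infsum f (Sigma I J) = (\<Sum>i\<in>I. infsum (\<lambda>j. f (i, j)) (J i))"
proof -
  have "infsum f (Sigma I J) = infsum f (\<Union>i\<in>I. Pair i ` J i)"
    by (rule arg_cong[of _ _ "infsum f"]) auto
  also have "\<dots> = (\<Sum>i\<in>I. infsum f (Pair i ` J i))"
    using assms by (intro sum_infsum[symmetric]) (auto intro: summable_on_ennreal_any)
  also have "\<dots> = (\<Sum>i\<in>I. infsum (\<lambda>j. f (i, j)) (J i))"
    by (intro sum.cong refl, subst infsum_reindex) (auto simp: inj_on_def o_def)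
  finally show ?thesis .
qed

section \<open>Tangent lines of the power function\<close>

lemma powr_le_linear:
  fixes a v :: real
  assumes "0 \<le> a" "a \<le> 1" "0 \<le> v"
  shows "v powr a \<le> 1 + a * (v - 1)"
  \<comment> \<open>Bernoulli's inequality as weighted arithmetic-geometric mean inequality: weights
    \<open>a\<close> and \<open>1 - a\<close> at the numbers \<open>v\<close> and 1.\<close>
  using Youngs_inequality_0[of a "1 - a" v 1] assms
  by (cases "a = 0"; cases "v = 0") (auto simp: algebra_simps)

text \<open>The tangent inequalities for the power function at \<open>x\<close>, arranged without subtractions
  so that they can be summed over \<open>[0, \<infinity>]\<close>.\<close>

lemma powr_tangent_le_1:
  fixes x t q :: real
  assumes "0 < q" "q \<le> 1" "0 < x" "0 \<le> t"
  shows "t powr q \<le> (1 - q) * x powr q + q * x powr (q - 1) * t"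
proof -
  have "(t / x) powr q * x powr q \<le> (1 + q * (t / x - 1)) * x powr q"
    using assms by (intro mult_right_mono powr_le_linear) auto
  then show ?thesis
    using assms by (simp add: powr_divide powr_diff field_simps)
qed

lemma powr_tangent_ge_1:
  fixes x t q :: real
  assumes "1 \<le> q" "0 < x" "0 \<le> t"
  shows "q * x powr (q - 1) * t \<le> t powr q + (q - 1) * x powr q"
proof -
  \<comment> \<open>For \<open>q\<close> at least 1 the exponent \<open>1 / q\<close> is admissible
    in Bernoulli's inequality, which is applied to \<open>(t / x) powr q\<close>.\<close>
  have "((t / x) powr q) powr (1 / q) \<le> 1 + (1 / q) * ((t / x) powr q - 1)"
    using assms by (intro powr_le_linear) auto
  then have "q * (t / x) \<le> q * (1 + (1 / q) * ((t / x) powr q - 1))"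
    using assms by (intro mult_left_mono) (auto simp: powr_powr)
  also have "\<dots> = q + (t / x) powr q - 1"
    using assms by (simp add: distrib_left)
  finally have "q * (t / x) * x powr q \<le> (q + (t / x) powr q - 1) * x powr q"
    by (intro mult_right_mono) auto
  then have "q * ((t / x) * x powr q) \<le> (t / x) powr q * x powr q + (q - 1) * x powr q"
    by (simp add: algebra_simps)
  moreover have "(t / x) * x powr q = x powr (q - 1) * t" "(t / x) powr q * x powr q = t powr q"
    using assms by (simp_all add: powr_diff powr_divide)
  ultimately show ?thesis
    by (simp only: mult.assoc)
qed

text \<open>Jensen's inequality for a matrix: the tangent of the convex power at \<open>x j\<close>
  is evaluated at every \<open>m k\<close>, weighted by \<open>w j k\<close> and summed over
  \<open>k\<close>. The constant term of the tangent is \<open>- d\<close> with \<open>d\<close>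
  nonnegative, so row sums below 1 are enough. Columns with \<open>m k = 0\<close> are left
  unconstrained because the weights applied later divide by \<open>m k\<close>.\<close>

lemma substochastic_powr_le:
  fixes w :: "'j \<Rightarrow> 'k \<Rightarrow> real" and x :: "'j \<Rightarrow> real" and m :: "'k \<Rightarrow> real"
  assumes q: "1 \<le> q"
    and nonneg: "\<And>j k. j \<in> J \<Longrightarrow> k \<in> K \<Longrightarrow> 0 \<le> w j k"
      "\<And>j. j \<in> J \<Longrightarrow> 0 \<le> x j" "\<And>k. k \<in> K \<Longrightarrow> 0 \<le> m k"
    and x: "\<And>j. j \<in> J \<Longrightarrow> ennreal (x j) = (\<Sum>\<^sub>\<infinity>k\<in>K. ennreal (m k * w j k))"
    and rows: "\<And>j. j \<in> J \<Longrightarrow> (\<Sum>\<^sub>\<infinity>k\<in>K. ennreal (w j k)) \<le> 1"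
    and cols: "\<And>k. k \<in> K \<Longrightarrow> m k \<noteq> 0 \<Longrightarrow> (\<Sum>\<^sub>\<infinity>j\<in>J. ennreal (w j k)) \<le> 1"
  shows "(\<Sum>\<^sub>\<infinity>j\<in>J. ennreal (x j powr q)) \<le> (\<Sum>\<^sub>\<infinity>k\<in>K. ennreal (m k powr q))"
proof -
  have row: "ennreal (x j powr q) \<le> (\<Sum>\<^sub>\<infinity>k\<in>K. ennreal (m k powr q * w j k))" if j: "j \<in> J" for j
  proof (cases "x j = 0")
    case False
    \<comment> \<open>The tangent of the power function at \<open>x j\<close> is
      \<open>c * t - d\<close>; the term \<open>d\<close> is carried on the other side and cancelled
      at the end, being finite.\<close>
    define c where "c = q * x j powr (q - 1)"
    define d where "d = (q - 1) * x j powr q"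
    have xpos: "0 < x j"
      using False nonneg(2)[OF j] by simp
    have cd: "0 \<le> c" "0 \<le> d"
      using q by (auto simp: c_def d_def)
    have "ennreal (x j powr q) + ennreal d = ennreal (c * x j)"
      using xpos cd q by (subst ennreal_plus[symmetric])
        (auto simp: c_def d_def powr_diff field_simps)
    also have "\<dots> = ennreal c * (\<Sum>\<^sub>\<infinity>k\<in>K. ennreal (m k * w j k))"
      using cd nonneg(2)[OF j] by (simp add: ennreal_mult x[OF j, symmetric])
    also have "\<dots> = (\<Sum>\<^sub>\<infinity>k\<in>K. ennreal (c * (m k * w j k)))"
      using cd nonneg j by (subst infsum_cmult_right_ennreal[symmetric])
        (auto intro!: infsum_cong simp: ennreal_mult)
    also have "\<dots> \<le> (\<Sum>\<^sub>\<infinity>k\<in>K. ennreal (m k powr q * w j k) + ennreal d * ennreal (w j k))"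
    proof (rule infsum_mono_ennreal)
      fix k assume k: "k \<in> K"
      have "c * m k * w j k \<le> (m k powr q + d) * w j k"
        unfolding c_def d_def using q xpos nonneg(3)[OF k] nonneg(1)[OF j k]
        by (intro mult_right_mono powr_tangent_ge_1) auto
      then show "ennreal (c * (m k * w j k)) \<le> ennreal (m k powr q * w j k) + ennreal d * ennreal (w j k)"
        using cd nonneg(1)[OF j k]
        by (auto simp flip: ennreal_plus ennreal_mult simp: algebra_simps intro!: ennreal_leI)
    qed
    also have "\<dots> = (\<Sum>\<^sub>\<infinity>k\<in>K. ennreal (m k powr q * w j k)) + ennreal d * (\<Sum>\<^sub>\<infinity>k\<in>K. ennreal (w j k))"
      by (simp add: infsum_add summable_on_ennreal_any infsum_cmult_right_ennreal)
    also have "\<dots> \<le> (\<Sum>\<^sub>\<infinity>k\<in>K. ennreal (m k powr q * w j k)) + ennreal d"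
      using mult_left_mono[OF rows[OF j], of "ennreal d"] by (intro add_left_mono) auto
    finally show ?thesis
      by (simp add: ennreal_add_left_cancel_le add.commute[of _ "ennreal d"])
  qed simp
  have "(\<Sum>\<^sub>\<infinity>j\<in>J. ennreal (x j powr q)) \<le> (\<Sum>\<^sub>\<infinity>j\<in>J. \<Sum>\<^sub>\<infinity>k\<in>K. ennreal (m k powr q * w j k))"
    by (intro infsum_mono_ennreal row)
  also have "\<dots> = (\<Sum>\<^sub>\<infinity>k\<in>K. \<Sum>\<^sub>\<infinity>j\<in>J. ennreal (m k powr q * w j k))"
    by (rule infsum_swap_ennreal)
  also have "\<dots> = (\<Sum>\<^sub>\<infinity>k\<in>K. ennreal (m k powr q) * (\<Sum>\<^sub>\<infinity>j\<in>J. ennreal (w j k)))"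
    using nonneg(1) by (subst infsum_cmult_right_ennreal[symmetric])
      (auto intro!: infsum_cong simp: ennreal_mult)
  also have "\<dots> \<le> (\<Sum>\<^sub>\<infinity>k\<in>K. ennreal (m k powr q))"
  proof (rule infsum_mono_ennreal)
    fix k assume k: "k \<in> K"
    show "ennreal (m k powr q) * (\<Sum>\<^sub>\<infinity>j\<in>J. ennreal (w j k)) \<le> ennreal (m k powr q)"
      using mult_left_mono[OF cols[OF k], of "ennreal (m k powr q)"] by (cases "m k = 0") auto
  qed
  finally show ?thesis .
qed

text \<open>The concave counterpart. The tangent at \<open>x j\<close> is now
  \<open>d + c * t\<close> with \<open>d\<close> again nonnegative, so the rows are still bounded
  above by 1, whereas the columns must have sum at least 1 to recover every
  \<open>m k powr q\<close>.\<close>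

lemma substochastic_powr_ge:
  fixes w :: "'j \<Rightarrow> 'k \<Rightarrow> real" and x :: "'j \<Rightarrow> real" and m :: "'k \<Rightarrow> real"
  assumes q: "0 < q" "q \<le> 1"
    and nonneg: "\<And>j k. j \<in> J \<Longrightarrow> k \<in> K \<Longrightarrow> 0 \<le> w j k"
      "\<And>j. j \<in> J \<Longrightarrow> 0 \<le> x j" "\<And>k. k \<in> K \<Longrightarrow> 0 \<le> m k"
    and x: "\<And>j. j \<in> J \<Longrightarrow> ennreal (x j) = (\<Sum>\<^sub>\<infinity>k\<in>K. ennreal (m k * w j k))"
    and rows: "\<And>j. j \<in> J \<Longrightarrow> (\<Sum>\<^sub>\<infinity>k\<in>K. ennreal (w j k)) \<le> 1"
    and cols: "\<And>k. k \<in> K \<Longrightarrow> m k \<noteq> 0 \<Longrightarrow> 1 \<le> (\<Sum>\<^sub>\<infinity>j\<in>J. ennreal (w j k))"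
  shows "(\<Sum>\<^sub>\<infinity>k\<in>K. ennreal (m k powr q)) \<le> (\<Sum>\<^sub>\<infinity>j\<in>J. ennreal (x j powr q))"
proof -
  have row: "(\<Sum>\<^sub>\<infinity>k\<in>K. ennreal (m k powr q * w j k)) \<le> ennreal (x j powr q)" if j: "j \<in> J" for j
  proof (cases "x j = 0")
    \<comment> \<open>No tangent is available at 0, but here \<open>m k * w j k\<close> vanishes for
      every \<open>k\<close>, and \<open>0 powr q = 0\<close>.\<close>
    case True
    have "ennreal (m k powr q * w j k) = 0" if k: "k \<in> K" for k
    proof -
      have "ennreal (m k * w j k) \<le> ennreal (x j)"
        unfolding x[OF j] using finite_sum_le_infsum_ennreal[of "{k}" K] k by auto
      then show ?thesis
        using True nonneg(1)[OF j k] nonneg(3)[OF k]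
        by (cases "m k = 0") (auto simp: ennreal_eq_0_iff mult_le_0_iff)
    qed
    then have "(\<Sum>\<^sub>\<infinity>k\<in>K. ennreal (m k powr q * w j k)) = 0"
      by (intro infsum_0) blast
    then show ?thesis
      by simp
  next
    case False
    define c where "c = q * x j powr (q - 1)"
    define d where "d = (1 - q) * x j powr q"
    have xpos: "0 < x j"
      using False nonneg(2)[OF j] by simp
    have cd: "0 \<le> c" "0 \<le> d"
      using q by (auto simp: c_def d_def)
    have "(\<Sum>\<^sub>\<infinity>k\<in>K. ennreal (m k powr q * w j k))
        \<le> (\<Sum>\<^sub>\<infinity>k\<in>K. ennreal d * ennreal (w j k) + ennreal c * ennreal (m k * w j k))"
    proof (rule infsum_mono_ennreal)
      fix k assume k: "k \<in> K"
      have "m k powr q * w j k \<le> (d + c * m k) * w j k"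
        unfolding c_def d_def using q xpos nonneg(3)[OF k] nonneg(1)[OF j k]
        by (intro mult_right_mono powr_tangent_le_1) auto
      then show "ennreal (m k powr q * w j k) \<le> ennreal d * ennreal (w j k) + ennreal c * ennreal (m k * w j k)"
        using cd nonneg(1)[OF j k] nonneg(3)[OF k]
        by (auto simp flip: ennreal_plus ennreal_mult simp: algebra_simps intro!: ennreal_leI)
    qed
    also have "\<dots> = ennreal d * (\<Sum>\<^sub>\<infinity>k\<in>K. ennreal (w j k)) + ennreal c * ennreal (x j)"
      by (simp add: infsum_add summable_on_ennreal_any infsum_cmult_right_ennreal x[OF j])
    also have "\<dots> \<le> ennreal d + ennreal c * ennreal (x j)"
      using mult_left_mono[OF rows[OF j], of "ennreal d"] by (intro add_right_mono) auto
    also have "\<dots> = ennreal (x j powr q)"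
      using xpos cd by (simp flip: ennreal_plus ennreal_mult)
        (simp add: c_def d_def powr_diff field_simps)
    finally show ?thesis .
  qed
  have "(\<Sum>\<^sub>\<infinity>k\<in>K. ennreal (m k powr q)) \<le> (\<Sum>\<^sub>\<infinity>k\<in>K. ennreal (m k powr q) * (\<Sum>\<^sub>\<infinity>j\<in>J. ennreal (w j k)))"
  proof (rule infsum_mono_ennreal)
    fix k assume k: "k \<in> K"
    show "ennreal (m k powr q) \<le> ennreal (m k powr q) * (\<Sum>\<^sub>\<infinity>j\<in>J. ennreal (w j k))"
      using mult_left_mono[OF cols[OF k], of "ennreal (m k powr q)"] by (cases "m k = 0") auto
  qed
  also have "\<dots> = (\<Sum>\<^sub>\<infinity>k\<in>K. \<Sum>\<^sub>\<infinity>j\<in>J. ennreal (m k powr q * w j k))"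
    using nonneg(1) by (subst infsum_cmult_right_ennreal[symmetric])
      (auto intro!: infsum_cong simp: ennreal_mult)
  also have "\<dots> = (\<Sum>\<^sub>\<infinity>j\<in>J. \<Sum>\<^sub>\<infinity>k\<in>K. ennreal (m k powr q * w j k))"
    by (rule infsum_swap_ennreal)
  also have "\<dots> \<le> (\<Sum>\<^sub>\<infinity>j\<in>J. ennreal (x j powr q))"
    by (intro infsum_mono_ennreal row)
  finally show ?thesis .
qed

section \<open>Convexity of powers and Minkowski's inequality\<close>

lemma convex_on_powr_nonneg:
  fixes q :: real
  assumes "1 \<le> q"
  shows "convex_on {0..} (\<lambda>t. t powr q)"
proof (rule convex_onI)
  fix t x y :: real
  assume t: "0 < t" "t < 1" and xy: "x \<in> {0..}" "y \<in> {0..}"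
  define z where "z = (1 - t) *\<^sub>R x + t *\<^sub>R y"
  show "((1 - t) *\<^sub>R x + t *\<^sub>R y) powr q \<le> (1 - t) * x powr q + t * y powr q"
  proof (cases "z = 0")
    case True
    then show ?thesis
      unfolding z_def[symmetric] using assms t by simp
  next
    case False
    then have z: "0 < z"
      using t xy by (simp add: z_def less_le)
    \<comment> \<open>The tangent inequalities at \<open>z\<close> for \<open>x\<close> and
      \<open>y\<close> are averaged with the weights \<open>1 - t\<close> and \<open>t\<close>; the
      linear parts average to their value at \<open>z\<close>. The case \<open>z = 0\<close> is
      separate because tangents are taken at positive points.\<close>
    have "q * (z powr (q - 1) * z) = (1 - t) * (q * z powr (q - 1) * x) + t * (q * z powr (q - 1) * y)"
      by (simp add: z_def algebra_simps)
    also have "\<dots> \<le> (1 - t) * (x powr q + (q - 1) * z powr q) + t * (y powr q + (q - 1) * z powr q)"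
      using assms t xy z by (intro add_mono mult_left_mono powr_tangent_ge_1) auto
    also have "\<dots> = (1 - t) * x powr q + t * y powr q + (q - 1) * z powr q"
      by (simp add: algebra_simps)
    also have "z powr (q - 1) * z = z powr q"
      using z by (simp add: powr_diff)
    finally show ?thesis
      unfolding z_def[symmetric] by (simp add: algebra_simps)
  qed
qed auto

lemma concave_on_powr_nonneg:
  fixes q :: real
  assumes "0 < q" "q \<le> 1"
  shows "concave_on {0..} (\<lambda>t. t powr q)"
  unfolding concave_on_iff
proof (intro conjI ballI allI impI)
  fix x y u v :: real
  assume xy: "x \<in> {0..}" "y \<in> {0..}" and uv: "0 \<le> u" "0 \<le> v" "u + v = 1"
  define z where "z = u *\<^sub>R x + v *\<^sub>R y"
  show "u * x powr q + v * y powr q \<le> (u *\<^sub>R x + v *\<^sub>R y) powr q"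
  proof (cases "z = 0")
    case True
    then show ?thesis
      using uv xy by (auto simp: z_def add_nonneg_eq_0_iff)
  next
    case False
    then have z: "0 < z"
      using uv xy by (simp add: z_def less_le)
    have "u * x powr q + v * y powr q \<le> u * ((1 - q) * z powr q + q * z powr (q - 1) * x)
         + v * ((1 - q) * z powr q + q * z powr (q - 1) * y)"
      using assms uv xy z by (intro add_mono mult_left_mono powr_tangent_le_1) auto
    also have "\<dots> = (u + v) * ((1 - q) * z powr q) + q * (z powr (q - 1) * z)"
      by (simp add: z_def algebra_simps)
    also have "\<dots> = z powr q"
      using z uv(3) by (simp add: powr_diff algebra_simps)
    finally show ?thesis
      by (simp add: z_def)
  qed
qed auto

text \<open>Both forms of Minkowski's inequality follow by normalizing each sequence to have
  \<open>q\<close>-norm \<open>1\<close>, which turns the sum into a convex combination. The summands with \<open>a i = 0\<close>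
  are harmless since they get weight \<open>0\<close>.\<close>

lemma Minkowski_powr_le:
  fixes x :: "'i \<Rightarrow> 'k \<Rightarrow> real" and a :: "'i \<Rightarrow> real"
  assumes q: "1 \<le> q" and I: "finite I"
    and nonneg: "\<And>i k. i \<in> I \<Longrightarrow> k \<in> K \<Longrightarrow> 0 \<le> x i k" "\<And>i. i \<in> I \<Longrightarrow> 0 \<le> a i"
    and le: "\<And>i. i \<in> I \<Longrightarrow> (\<Sum>\<^sub>\<infinity>k\<in>K. ennreal (x i k powr q)) \<le> ennreal (a i powr q)"
  shows "(\<Sum>\<^sub>\<infinity>k\<in>K. ennreal ((\<Sum>i\<in>I. x i k) powr q)) \<le> ennreal ((\<Sum>i\<in>I. a i) powr q)"
proof -
  define N where "N = (\<Sum>i\<in>I. a i)"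
  have zero: "x i k = 0" if "i \<in> I" "k \<in> K" "a i = 0" for i k
  proof -
    have "ennreal (x i k powr q) \<le> ennreal (a i powr q)"
      using finite_sum_le_infsum_ennreal[of "{k}" K] that
      by (intro order.trans[OF _ le[OF that(1)]]) auto
    then show ?thesis
      using that by auto
  qed
  have N0: "0 \<le> N"
    unfolding N_def using nonneg(2) by (rule sum_nonneg)
  show ?thesis
  proof (cases "N = 0")
    case True
    then have "a i = 0" if "i \<in> I" for i
      using that I nonneg(2) by (simp add: N_def sum_nonneg_eq_0_iff)
    then have "(\<Sum>i\<in>I. x i k) = 0" if "k \<in> K" for k
      using zero that by simp
    then show ?thesis
      by (simp cong: infsum_cong)
  next
    case False
    then have N: "0 < N" "I \<noteq> {}"
      using N0 by (auto simp: N_def)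
    \<comment> \<open>The coefficients are those of Jensen's inequality with weights
      \<open>a i / N\<close> at the points \<open>x i k / a i\<close>, scaled by
      \<open>N powr q\<close>. Summed over \<open>k\<close>, row \<open>i\<close> contributes at
      most \<open>N powr q * (a i / N)\<close>.\<close>
    have "(\<Sum>\<^sub>\<infinity>k\<in>K. ennreal ((\<Sum>i\<in>I. x i k) powr q))
        \<le> (\<Sum>\<^sub>\<infinity>k\<in>K. \<Sum>i\<in>I. ennreal (N powr q * (a i / N) / a i powr q) * ennreal (x i k powr q))"
    proof (rule infsum_mono_ennreal)
      fix k assume k: "k \<in> K"
      have "(\<Sum>i\<in>I. x i k) = N * (\<Sum>i\<in>I. (a i / N) *\<^sub>R (x i k / a i))"
        unfolding sum_distrib_left using N zero k by (intro sum.cong) auto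
      then have "(\<Sum>i\<in>I. x i k) powr q = N powr q * (\<Sum>i\<in>I. (a i / N) *\<^sub>R (x i k / a i)) powr q"
        using N nonneg k by (simp add: powr_mult sum_nonneg)
      also have "\<dots> \<le> N powr q * (\<Sum>i\<in>I. a i / N * (x i k / a i) powr q)"
      proof (intro mult_left_mono)
        show "(\<Sum>i\<in>I. (a i / N) *\<^sub>R (x i k / a i)) powr q \<le> (\<Sum>i\<in>I. a i / N * (x i k / a i) powr q)"
          by (rule convex_on_sum[OF I N(2) convex_on_powr_nonneg[OF q]])
            (use N nonneg k in \<open>auto simp flip: sum_divide_distrib simp: N_def\<close>)
      qed auto
      also have "\<dots> = (\<Sum>i\<in>I. N powr q * (a i / N) / a i powr q * x i k powr q)"
        using nonneg k by (auto simp: sum_distrib_left powr_divide intro!: sum.cong)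
      also have "ennreal \<dots> = (\<Sum>i\<in>I. ennreal (N powr q * (a i / N) / a i powr q) * ennreal (x i k powr q))"
        using N nonneg k by (subst sum_ennreal[symmetric], simp)
          (rule sum.cong[OF refl], rule ennreal_mult, auto)
      finally show "ennreal ((\<Sum>i\<in>I. x i k) powr q) \<le> \<dots>"
        by (simp add: ennreal_leI)
    qed
    also have "\<dots> = (\<Sum>i\<in>I. ennreal (N powr q * (a i / N) / a i powr q) * (\<Sum>\<^sub>\<infinity>k\<in>K. ennreal (x i k powr q)))"
      using I by (simp add: infsum_sum_ennreal infsum_cmult_right_ennreal)
    also have "\<dots> \<le> (\<Sum>i\<in>I. ennreal (N powr q * (a i / N) / a i powr q) * ennreal (a i powr q))"
      by (intro sum_mono mult_left_mono le) auto
    also have "\<dots> = (\<Sum>i\<in>I. ennreal (N powr q * (a i / N)))"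
      using N nonneg(2) by (intro sum.cong refl) (auto simp flip: ennreal_mult)
    also have "\<dots> = ennreal (N powr q)"
      using N nonneg(2) by (subst sum_ennreal)
        (auto simp flip: sum_distrib_left sum_divide_distrib N_def)
    finally show ?thesis
      by (simp add: N_def)
  qed
qed

lemma Minkowski_powr_ge:
  fixes x :: "'i \<Rightarrow> 'k \<Rightarrow> real" and a :: "'i \<Rightarrow> real"
  assumes q: "0 < q" "q \<le> 1" and I: "finite I"
    and nonneg: "\<And>i k. i \<in> I \<Longrightarrow> k \<in> K \<Longrightarrow> 0 \<le> x i k" "\<And>i. i \<in> I \<Longrightarrow> 0 \<le> a i"
    and ge: "\<And>i. i \<in> I \<Longrightarrow> ennreal (a i powr q) \<le> (\<Sum>\<^sub>\<infinity>k\<in>K. ennreal (x i k powr q))"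
  shows "ennreal ((\<Sum>i\<in>I. a i) powr q) \<le> (\<Sum>\<^sub>\<infinity>k\<in>K. ennreal ((\<Sum>i\<in>I. x i k) powr q))"
proof -
  define N where "N = (\<Sum>i\<in>I. a i)"
  have N0: "0 \<le> N"
    unfolding N_def using nonneg(2) by (rule sum_nonneg)
  show ?thesis
  proof (cases "N = 0")
    case True
    then show ?thesis
      by (simp flip: N_def)
  next
    case False
    then have N: "0 < N" "I \<noteq> {}"
      using N0 by (auto simp: N_def)
    have "ennreal (N powr q) = (\<Sum>i\<in>I. ennreal (N powr q * (a i / N)))"
      using N nonneg(2) by (subst sum_ennreal)
        (auto simp flip: sum_distrib_left sum_divide_distrib N_def)
    also have "\<dots> = (\<Sum>i\<in>I. ennreal (N powr q * (a i / N) / a i powr q) * ennreal (a i powr q))"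
      using N nonneg(2) by (intro sum.cong refl) (auto simp flip: ennreal_mult)
    also have "\<dots> \<le> (\<Sum>i\<in>I. ennreal (N powr q * (a i / N) / a i powr q) * (\<Sum>\<^sub>\<infinity>k\<in>K. ennreal (x i k powr q)))"
      by (intro sum_mono mult_left_mono ge) auto
    also have "\<dots> = (\<Sum>\<^sub>\<infinity>k\<in>K. \<Sum>i\<in>I. ennreal (N powr q * (a i / N) / a i powr q) * ennreal (x i k powr q))"
      using I by (simp add: infsum_sum_ennreal infsum_cmult_right_ennreal)
    also have "\<dots> \<le> (\<Sum>\<^sub>\<infinity>k\<in>K. ennreal ((\<Sum>i\<in>I. x i k) powr q))"
    proof (rule infsum_mono_ennreal)
      fix k assume k: "k \<in> K"
      have "(\<Sum>i\<in>I. ennreal (N powr q * (a i / N) / a i powr q) * ennreal (x i k powr q))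
          = ennreal (\<Sum>i\<in>I. N powr q * (a i / N) / a i powr q * x i k powr q)"
        using N nonneg k by (subst sum_ennreal[symmetric], simp)
          (rule sum.cong[OF refl], rule ennreal_mult[symmetric], auto)
      also have "(\<Sum>i\<in>I. N powr q * (a i / N) / a i powr q * x i k powr q)
          = N powr q * (\<Sum>i\<in>I. a i / N * (x i k / a i) powr q)"
        using nonneg k by (auto simp: sum_distrib_left powr_divide intro!: sum.cong)
      also have "\<dots> \<le> N powr q * (\<Sum>i\<in>I. (a i / N) *\<^sub>R (x i k / a i)) powr q"
      proof (intro mult_left_mono)
        show "(\<Sum>i\<in>I. a i / N * (x i k / a i) powr q) \<le> (\<Sum>i\<in>I. (a i / N) *\<^sub>R (x i k / a i)) powr q"
          by (rule concave_on_sum[OF I N(2) concave_on_powr_nonneg[OF q]])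
            (use N nonneg k in \<open>auto simp flip: sum_divide_distrib simp: N_def\<close>)
      qed auto
      also have "\<dots> = (N * (\<Sum>i\<in>I. (a i / N) *\<^sub>R (x i k / a i))) powr q"
        using N nonneg k by (simp add: powr_mult sum_nonneg)
      \<comment> \<open>An inequality only: indices with \<open>a i = 0\<close> may have positive
        \<open>x i k\<close>, which are dropped on the left.\<close>
      also have "\<dots> \<le> (\<Sum>i\<in>I. x i k) powr q"
        unfolding sum_distrib_left using N nonneg k q
        by (intro powr_mono2 sum_mono sum_nonneg) auto
      finally show "(\<Sum>i\<in>I. ennreal (N powr q * (a i / N) / a i powr q) * ennreal (x i k powr q))
          \<le> ennreal ((\<Sum>i\<in>I. x i k) powr q)"
        by (simp add: ennreal_leI)
    qed
    finally show ?thesis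
      by (simp add: N_def)
  qed
qed

section \<open>Complex Hilbert spaces\<close>

subsection \<open>The inner product\<close>

lemma scaleR_scaleC: "r *\<^sub>R (x :: 'a::complex_inner_space) = complex_of_real r *\<^sub>C x"
  by (simp add: scaleC_of_real)

lemma additive_cinner_left: "Modules.additive (\<lambda>x. cinner x (y :: 'a::complex_inner_space))"
  by standard (rule cinner_add_left)

lemma cinner_add_right: "cinner x (y + z) = cinner x y + cinner x (z :: 'a::complex_inner_space)"
  by (subst (1 2 3) cinner_commute) (simp add: cinner_add_left)

lemma additive_cinner_right: "Modules.additive (\<lambda>y. cinner (x :: 'a::complex_inner_space) y)"
  by standard (rule cinner_add_right)

lemmas cinner_zero_left [simp] = Modules.additive.zero [OF additive_cinner_left]
  and cinner_zero_right [simp] = Modules.additive.zero [OF additive_cinner_right]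
  and cinner_diff_left = Modules.additive.diff [OF additive_cinner_left]
  and cinner_minus_left = Modules.additive.minus [OF additive_cinner_left]
  and cinner_sum_left = Modules.additive.sum [OF additive_cinner_left]
  and cinner_sum_right = Modules.additive.sum [OF additive_cinner_right]

lemma cinner_scaleC_right: "cinner x (c *\<^sub>C y) = cnj c * cinner x (y :: 'a::complex_inner_space)"
  by (subst (1 2) cinner_commute) (simp add: cinner_scaleC_left)

lemma cinner_scaleR_left: "cinner (r *\<^sub>R x) y = complex_of_real r * cinner x (y :: 'a::complex_inner_space)"
  by (simp add: scaleR_scaleC cinner_scaleC_left)

lemma cinner_scaleR_right: "cinner x (r *\<^sub>R y) = complex_of_real r * cinner x (y :: 'a::complex_inner_space)"
  by (simp add: scaleR_scaleC cinner_scaleC_right)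

lemma cinner_self: "cinner x x = complex_of_real ((norm (x :: 'a::complex_inner_space))\<^sup>2)"
proof -
  have "Im (cinner x x) = 0"
    using arg_cong[OF cinner_commute[of x x], of Im] by simp
  moreover have "Re (cinner x x) = (norm x)\<^sup>2"
    by (simp add: inner_eq_Re_cinner[symmetric] power2_norm_eq_inner)
  ultimately show ?thesis
    by (simp add: complex_eq_iff)
qed

lemma cmod_cinner_commute: "cmod (cinner x y) = cmod (cinner y (x :: 'a::complex_inner_space))"
  by (subst cinner_commute) simp

lemma norm_scaleC [simp]: "norm (c *\<^sub>C x) = cmod c * norm (x :: 'a::complex_inner_space)"
proof -
  have "complex_of_real ((norm (c *\<^sub>C x))\<^sup>2) = c * cnj c * complex_of_real ((norm x)\<^sup>2)"
    unfolding cinner_self[symmetric] by (simp add: cinner_scaleC_left cinner_scaleC_right)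
  also have "\<dots> = complex_of_real ((cmod c * norm x)\<^sup>2)"
    by (simp add: complex_norm_square power_mult_distrib del: of_real_power)
  finally have "(norm (c *\<^sub>C x))\<^sup>2 = (cmod c * norm x)\<^sup>2"
    using of_real_eq_iff by blast
  then show ?thesis
    by (simp add: power2_eq_iff_nonneg)
qed

text \<open>Multiplying \<open>x\<close> by the unimodular number \<open>u\<close> makes the inner
  product real and nonnegative, so the real Cauchy-Schwarz inequality applies.\<close>

lemma cmod_cinner_le: "cmod (cinner x y) \<le> norm x * norm (y :: 'a::complex_inner_space)"
proof (cases "cinner x y = 0")
  case False
  define u where "u = cnj (cinner x y) / complex_of_real (cmod (cinner x y))"
  have "complex_of_real (cmod (cinner x y)) = u * cinner x y"
    using False by (simp add: u_def field_simps power2_eq_square flip: complex_norm_square)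
  then have "cmod (cinner x y) = Re (u * cinner x y)"
    by (metis Re_complex_of_real)
  also have "\<dots> = inner (u *\<^sub>C x) y"
    by (simp only: inner_eq_Re_cinner cinner_scaleC_left)
  also have "\<dots> \<le> norm (u *\<^sub>C x) * norm y"
    by (rule norm_cauchy_schwarz)
  also have "norm (u *\<^sub>C x) = norm x"
    using False by (simp add: u_def norm_divide)
  finally show ?thesis .
qed simp

lemma bounded_linear_cinner_left: "bounded_linear (\<lambda>x. cinner x (y :: 'a::complex_inner_space))"
  by (rule bounded_linear_intro[where K="norm y"])
    (auto simp: cinner_add_left cinner_scaleR_left cmod_cinner_le scaleR_conv_of_real)

lemma bounded_operators_add:
  "S \<in> bounded_operators \<Longrightarrow> T \<in> bounded_operators \<Longrightarrow> S + T \<in> bounded_operators"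
  by (auto simp: bounded_operators_def blinfun.add_left scaleC_add_right)

lemma scaleC_minus_right: "c *\<^sub>C (- x) = - (c *\<^sub>C (x :: 'a::complex_inner_space))"
  by (metis add.inverse_unique add_cancel_right_right scaleC_add_right right_minus)

lemma bounded_operators_uminus:
  "T \<in> bounded_operators \<Longrightarrow> - T \<in> bounded_operators"
  by (auto simp: bounded_operators_def blinfun.minus_left scaleC_minus_right)

lemma bounded_operators_compose:
  "S \<in> bounded_operators \<Longrightarrow> T \<in> bounded_operators \<Longrightarrow> S o\<^sub>L T \<in> bounded_operators"
  by (auto simp: bounded_operators_def)

lemma bounded_operators_scaleC:
  "T \<in> bounded_operators \<Longrightarrow> blinfun_apply T (c *\<^sub>C x) = c *\<^sub>C blinfun_apply T x"
  by (simp add: bounded_operators_def)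

subsection \<open>Orthonormal expansions\<close>

definition orthonormal :: "'a::complex_inner_space set \<Rightarrow> bool"
  where "orthonormal B \<longleftrightarrow> (\<forall>e\<in>B. norm e = 1) \<and> (\<forall>e\<in>B. \<forall>f\<in>B. e \<noteq> f \<longrightarrow> cinner e f = 0)"

lemma orthonormal_basis_iff:
  "orthonormal_basis B \<longleftrightarrow> orthonormal B \<and> (\<forall>x. (\<forall>e\<in>B. cinner x e = 0) \<longrightarrow> x = 0)"
  by (auto simp: orthonormal_basis_def orthonormal_def)

lemma orthonormal_basis_imp_orthonormal: "orthonormal_basis B \<Longrightarrow> orthonormal B"
  by (simp add: orthonormal_basis_iff)

lemma orthonormal_norm: "orthonormal B \<Longrightarrow> e \<in> B \<Longrightarrow> norm e = 1"
  by (simp add: orthonormal_def)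

lemma cinner_orthonormal:
  "orthonormal B \<Longrightarrow> e \<in> B \<Longrightarrow> f \<in> B \<Longrightarrow> cinner e f = (if e = f then 1 else 0)"
  by (auto simp: orthonormal_def cinner_self)

lemma orthonormal_basis_eqI:
  assumes "orthonormal_basis B" "\<And>e. e \<in> B \<Longrightarrow> cinner x e = cinner y e"
  shows "x = y"
proof -
  have "\<forall>e\<in>B. cinner (x - y) e = 0"
    using assms(2) by (simp add: cinner_diff_left)
  then have "x - y = 0"
    using assms(1) unfolding orthonormal_basis_iff by blast
  then show ?thesis
    by simp
qed

lemma norm_orthonormal_sum:
  assumes "orthonormal B" "finite F" "F \<subseteq> B"
  shows "(norm (\<Sum>e\<in>F. c e *\<^sub>C e))\<^sup>2 = (\<Sum>e\<in>F. (cmod (c e))\<^sup>2)"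
proof -
  have "complex_of_real ((norm (\<Sum>e\<in>F. c e *\<^sub>C e))\<^sup>2)
      = (\<Sum>e\<in>F. c e * (\<Sum>f\<in>F. cnj (c f) * cinner e f))"
    unfolding cinner_self[symmetric]
    unfolding cinner_sum_left cinner_scaleC_left
    by (intro sum.cong refl) (simp add: cinner_sum_right cinner_scaleC_right)
  also have "\<dots> = (\<Sum>e\<in>F. c e * (\<Sum>f\<in>F. if e = f then cnj (c f) else 0))"
    using assms by (intro sum.cong refl arg_cong2[of _ _ _ _ "(*)"])
      (auto simp: cinner_orthonormal[OF assms(1)] subset_iff)
  also have "\<dots> = complex_of_real (\<Sum>e\<in>F. (cmod (c e))\<^sup>2)"
    using assms(2) by (simp add: complex_norm_square del: of_real_power)
  finally show ?thesis
    using of_real_eq_iff by blast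
qed

text \<open>The projection \<open>y\<close> of \<open>x\<close> to the span of \<open>F\<close>
  satisfies \<open>inner x y = (norm y)\<^sup>2\<close>; the inequality is the nonnegativity of the
  squared norm of \<open>x - y\<close>.\<close>

lemma Bessel_inequality:
  assumes "orthonormal B" "finite F" "F \<subseteq> B"
  shows "(\<Sum>e\<in>F. (cmod (cinner x e))\<^sup>2) \<le> (norm x)\<^sup>2"
proof -
  define y where "y = (\<Sum>e\<in>F. cinner x e *\<^sub>C e)"
  have y: "(norm y)\<^sup>2 = (\<Sum>e\<in>F. (cmod (cinner x e))\<^sup>2)"
    unfolding y_def by (rule norm_orthonormal_sum[OF assms])
  have "cinner x y = complex_of_real (\<Sum>e\<in>F. (cmod (cinner x e))\<^sup>2)"
    by (simp add: y_def cinner_sum_right cinner_scaleC_right complex_norm_square mult.commute del: of_real_power)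
  then have "inner x y = (norm y)\<^sup>2"
    by (simp add: inner_eq_Re_cinner y)
  moreover have "0 \<le> (norm (x - y))\<^sup>2"
    by simp
  ultimately show ?thesis
    unfolding y[symmetric] by (simp add: power2_norm_eq_inner inner_diff inner_commute)
qed

text \<open>The Riesz-Fischer theorem: by Pythagoras the squared distance of nested partial sums is
  a difference of partial sums of the numeric series, so the net of finite sums is Cauchy.\<close>

lemma orthonormal_summable:
  fixes B :: "'a::complex_hilbert_space set"
  assumes B: "orthonormal B"
    and bound: "\<And>F. finite F \<Longrightarrow> F \<subseteq> B \<Longrightarrow> (\<Sum>e\<in>F. (cmod (c e))\<^sup>2) \<le> M"
  shows "(\<lambda>e. c e *\<^sub>C e) summable_on B"
proof -
  let ?s = "sum (\<lambda>e. c e *\<^sub>C e)"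
  let ?t = "sum (\<lambda>e. (cmod (c e))\<^sup>2)"
  have "(\<lambda>e. (cmod (c e))\<^sup>2) summable_on B"
    using bound by (intro nonneg_bdd_above_summable_on) (auto intro!: bdd_aboveI)
  then have sums: "((\<lambda>e. (cmod (c e))\<^sup>2) has_sum infsum (\<lambda>e. (cmod (c e))\<^sup>2) B) B"
    by simp
  have "cauchy_filter (filtermap ?s (finite_subsets_at_top B))"
    unfolding cauchy_filter_metric_filtermap
  proof (intro allI impI)
    fix \<epsilon> :: real assume \<epsilon>: "0 < \<epsilon>"
    then have "0 < (\<epsilon> / 2)\<^sup>2 / 2"
      by simp
    from has_sum_finite_approximation[OF sums this]
    obtain F0 where F0: "finite F0" "F0 \<subseteq> B" "dist (?t F0) (infsum (\<lambda>e. (cmod (c e))\<^sup>2) B) \<le> (\<epsilon> / 2)\<^sup>2 / 2"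
      by blast
    have close: "norm (?s F - ?s F0) < \<epsilon> / 2" if F: "finite F" "F \<subseteq> B" "F0 \<subseteq> F" for F
    proof -
      have "(norm (?s F - ?s F0))\<^sup>2 = (norm (?s (F - F0)))\<^sup>2"
        using F by (simp add: sum_diff)
      also have "\<dots> = ?t (F - F0)"
        using F by (intro norm_orthonormal_sum[OF B]) auto
      also have "\<dots> = ?t F - ?t F0"
        using F by (simp add: sum_diff)
      finally have "(norm (?s F - ?s F0))\<^sup>2 = ?t F - ?t F0" .
      moreover have "?t F \<le> infsum (\<lambda>e. (cmod (c e))\<^sup>2) B"
        by (rule finite_sum_le_has_sum[OF sums F(1,2)]) simp
      moreover have "infsum (\<lambda>e. (cmod (c e))\<^sup>2) B - ?t F0 \<le> (\<epsilon> / 2)\<^sup>2 / 2"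
        using F0(3) by (simp only: dist_real_def abs_le_iff minus_diff_eq)
      ultimately have "(norm (?s F - ?s F0))\<^sup>2 < (\<epsilon> / 2)\<^sup>2"
        using \<open>0 < (\<epsilon> / 2)\<^sup>2 / 2\<close> by argo
      then show ?thesis
        by (rule power_less_imp_less_base) (use \<epsilon> in simp)
    qed
    show "\<exists>P. eventually P (finite_subsets_at_top B) \<and> (\<forall>x y. P x \<and> P y \<longrightarrow> dist (?s x) (?s y) < \<epsilon>)"
    proof (intro exI conjI allI impI)
      show "eventually (\<lambda>F. finite F \<and> F \<subseteq> B \<and> F0 \<subseteq> F) (finite_subsets_at_top B)"
        unfolding eventually_finite_subsets_at_top using F0 by blast
      fix F G assume "(finite F \<and> F \<subseteq> B \<and> F0 \<subseteq> F) \<and> (finite G \<and> G \<subseteq> B \<and> F0 \<subseteq> G)"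
      then have "dist (?s F) (?s F0) < \<epsilon> / 2" "dist (?s G) (?s F0) < \<epsilon> / 2"
        using close by (auto simp: dist_norm)
      then show "dist (?s F) (?s G) < \<epsilon>"
        by (rule dist_triangle_half_l)
    qed
  qed
  then obtain x where "filtermap ?s (finite_subsets_at_top B) \<le> nhds x"
    using cauchy_filter_complete_converges[of "filtermap ?s (finite_subsets_at_top B)" UNIV]
      complete_UNIV_cuspace
    by (auto simp: filtermap_bot_iff)
  then have "(?s \<longlongrightarrow> x) (finite_subsets_at_top B)"
    by (auto simp: filterlim_def)
  then show ?thesis
    by (auto simp: summable_on_def has_sum_def)
qed

lemma cinner_has_sum_orthonormal:
  assumes B: "orthonormal B" and y: "((\<lambda>e. c e *\<^sub>C e) has_sum y) B" and f: "f \<in> B"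
  shows "cinner y f = c f"
proof -
  have "((\<lambda>e. c e * cinner e f) has_sum cinner y f) B"
    using has_sum_bounded_linear[OF bounded_linear_cinner_left[of f] y] by (simp add: cinner_scaleC_left)
  moreover have "((\<lambda>e. c e * cinner e f) has_sum c f) B"
    using f by (intro has_sum_finite_neutralI[of "{f}"]) (auto simp: cinner_orthonormal[OF B])
  ultimately show ?thesis
    by (rule has_sum_unique)
qed

text \<open>The means of constructing operators: the value at a vector is prescribed by its
  coefficients, and only their square-summability has to be checked.\<close>

lemma orthonormal_coefficients:
  fixes B :: "'a::complex_hilbert_space set"
  assumes B: "orthonormal B"
    and bound: "\<And>F. finite F \<Longrightarrow> F \<subseteq> B \<Longrightarrow> (\<Sum>e\<in>F. (cmod (c e))\<^sup>2) \<le> M"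
  obtains y where "\<And>e. e \<in> B \<Longrightarrow> cinner y e = c e"
  using orthonormal_summable[OF assms] cinner_has_sum_orthonormal[OF B]
  by (auto simp: summable_on_def)

text \<open>Bessel's inequality makes the series converge; its sum has the same coefficients as
  \<open>x\<close>, hence equals \<open>x\<close> by maximality of \<open>B\<close>.\<close>

lemma orthonormal_basis_expansion:
  assumes "orthonormal_basis B"
  shows "((\<lambda>e. cinner x e *\<^sub>C e) has_sum x) B"
proof -
  have B: "orthonormal B"
    using assms by (rule orthonormal_basis_imp_orthonormal)
  have "(\<lambda>e. cinner x e *\<^sub>C e) summable_on B"
    by (rule orthonormal_summable[OF B Bessel_inequality[OF B]])
  then obtain y where y: "((\<lambda>e. cinner x e *\<^sub>C e) has_sum y) B"
    by (auto simp: summable_on_def)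
  have "y = x"
    by (rule orthonormal_basis_eqI[OF assms]) (rule cinner_has_sum_orthonormal[OF B y])
  then show ?thesis
    using y by simp
qed

lemma bounded_operators_expansion:
  assumes "orthonormal_basis B" "T \<in> bounded_operators"
  shows "((\<lambda>e. cinner x e *\<^sub>C blinfun_apply T e) has_sum blinfun_apply T x) B"
  using has_sum_bounded_linear[OF blinfun.bounded_linear_right orthonormal_basis_expansion[OF assms(1), of x], of T]
  by (simp add: bounded_operators_scaleC[OF assms(2)])

lemma Parseval:
  assumes "orthonormal_basis B"
  shows "((\<lambda>e. (cmod (cinner x e))\<^sup>2) has_sum (norm x)\<^sup>2) B"
proof -
  have "((\<lambda>e. Re (cinner (cinner x e *\<^sub>C e) x)) has_sum Re (cinner x x)) B"
    using has_sum_Re[OF has_sum_bounded_linear[OF bounded_linear_cinner_left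
        orthonormal_basis_expansion[OF assms]]] .
  moreover have "Re (cinner (cinner x e *\<^sub>C e) x) = (cmod (cinner x e))\<^sup>2" for e
    by (subst cinner_scaleC_left, subst (2) cinner_commute) (simp flip: complex_norm_square of_real_power)
  ultimately show ?thesis
    by (simp add: cinner_self)
qed

lemma Parseval_ennreal:
  assumes "orthonormal_basis B"
  shows "(\<Sum>\<^sub>\<infinity>e\<in>B. ennreal ((cmod (cinner x e))\<^sup>2)) = ennreal ((norm x)\<^sup>2)"
  by (rule infsum_ennreal_has_sum[OF Parseval[OF assms]]) simp

text \<open>The form in which the spectral theorem is used. Eigenvalues are indexed by basis
  vectors, so that sums over \<open>B\<close> count multiplicities, and a function of the operator
  is described by the same \<open>B\<close> with a new eigenvalue function.\<close>

definition eigenbasis :: "('a::complex_hilbert_space \<Rightarrow>\<^sub>L 'a) \<Rightarrow> 'a set \<Rightarrow> ('a \<Rightarrow> real) \<Rightarrow> bool"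
  where "eigenbasis T B l \<longleftrightarrow> T \<in> bounded_operators \<and> orthonormal_basis B \<and>
    (\<forall>e\<in>B. 0 \<le> l e \<and> blinfun_apply T e = l e *\<^sub>R e)"

lemma eigenbasisD:
  assumes "eigenbasis T B l"
  shows "T \<in> bounded_operators" "orthonormal_basis B" "orthonormal B"
    "e \<in> B \<Longrightarrow> 0 \<le> l e" "e \<in> B \<Longrightarrow> blinfun_apply T e = l e *\<^sub>R e"
  using assms by (auto simp: eigenbasis_def orthonormal_basis_imp_orthonormal)

lemma bounded_operators_eqI:
  assumes "orthonormal_basis B" "S \<in> bounded_operators" "T \<in> bounded_operators"
    and "\<And>e. e \<in> B \<Longrightarrow> blinfun_apply S e = blinfun_apply T e"
  shows "S = T"
proof (rule blinfun_eqI)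
  fix x
  have "((\<lambda>e. cinner x e *\<^sub>C blinfun_apply T e) has_sum blinfun_apply S x) B"
    using bounded_operators_expansion[OF assms(1,2), of x] assms(4)
      has_sum_cong[of B "\<lambda>e. cinner x e *\<^sub>C blinfun_apply S e" "\<lambda>e. cinner x e *\<^sub>C blinfun_apply T e"] by simp
  then show "blinfun_apply S x = blinfun_apply T x"
    using bounded_operators_expansion[OF assms(1,3)] by (rule has_sum_unique)
qed

lemma cinner_eigenbasis:
  assumes T: "eigenbasis T B l" and e: "e \<in> B"
  shows "cinner (blinfun_apply T x) e = complex_of_real (l e) * cinner x e"
proof -
  have "cinner x e *\<^sub>C blinfun_apply T e = (cinner x e * complex_of_real (l e)) *\<^sub>C e" if "e \<in> B" for e
    by (simp only: eigenbasisD(5)[OF T that] scaleR_scaleC scaleC_scaleC)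
  then have "((\<lambda>e. (cinner x e * complex_of_real (l e)) *\<^sub>C e) has_sum blinfun_apply T x) B"
    using bounded_operators_expansion[OF eigenbasisD(2,1)[OF T], of x]
      has_sum_cong[of B "\<lambda>e. cinner x e *\<^sub>C blinfun_apply T e"
        "\<lambda>e. (cinner x e * complex_of_real (l e)) *\<^sub>C e"] by simp
  from cinner_has_sum_orthonormal[OF eigenbasisD(3)[OF T] this e]
  show ?thesis
    by (simp add: mult.commute)
qed

text \<open>Kept complex so that both the vanishing imaginary part and the sign of the real part can
  be read off for positivity.\<close>

lemma cinner_quadratic_form_eigenbasis:
  assumes T: "eigenbasis T B l"
  shows "((\<lambda>e. complex_of_real (l e * (cmod (cinner x e))\<^sup>2)) has_sum cinner (blinfun_apply T x) x) B"
proof -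
  have "cinner (cinner x e *\<^sub>C blinfun_apply T e) x = complex_of_real (l e * (cmod (cinner x e))\<^sup>2)"
    if "e \<in> B" for e
  proof -
    have "cinner (cinner x e *\<^sub>C blinfun_apply T e) x = cinner x e * (complex_of_real (l e) * cnj (cinner x e))"
      unfolding eigenbasisD(5)[OF T that] cinner_scaleR_left cinner_scaleC_left
      by (subst (2) cinner_commute) (rule refl)
    then show ?thesis
      unfolding of_real_mult complex_norm_square by (simp only: mult.left_commute)
  qed
  then show ?thesis
    using has_sum_bounded_linear[OF bounded_linear_cinner_left[of x]
        bounded_operators_expansion[OF eigenbasisD(2,1)[OF T], of x]]
      has_sum_cong[of B "\<lambda>e. cinner (cinner x e *\<^sub>C blinfun_apply T e) x"
        "\<lambda>e. complex_of_real (l e * (cmod (cinner x e))\<^sup>2)"] by simp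
qed

lemma eigenbasis_imp_positive_op:
  assumes T: "eigenbasis T B l"
  shows "positive_op T"
  unfolding positive_op_def
proof (intro conjI allI)
  fix x
  note sum = cinner_quadratic_form_eigenbasis[OF T, of x]
  have "0 \<le> Re (cinner (blinfun_apply T x) x)"
    using has_sum_Re[OF sum] by (rule has_sum_nonneg) (auto simp: eigenbasisD(4)[OF T])
  moreover have "Im (cinner (blinfun_apply T x) x) = 0"
    using has_sum_Im[OF sum] by (simp add: has_sum_unique)
  ultimately show "cinner (blinfun_apply T x) x \<in> \<real>\<^sub>\<ge>\<^sub>0"
    by (simp add: complex_nonneg_Reals_iff)
qed (rule eigenbasisD(1)[OF T])

lemma quadratic_form_eigenbasis:
  assumes T: "eigenbasis T B l"
  shows "((\<lambda>e. l e * (cmod (cinner x e))\<^sup>2) has_sum Re (cinner (blinfun_apply T x) x)) B"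
  using has_sum_Re[OF cinner_quadratic_form_eigenbasis[OF T]] by simp

text \<open>\<open>d x\<close> is the vector with coefficients \<open>f e * cinner x e\<close>,
  square-summable since \<open>f\<close> is bounded; linearity is checked coefficientwise and the
  norm bound is Parseval's identity. This yields the square roots and powers demanded by
  \<open>abs_op\<close> and \<open>op_powr\<close>.\<close>

lemma diagonal_operator_exists:
  fixes B :: "'a::complex_hilbert_space set"
  assumes B: "orthonormal_basis B" and f: "\<And>e. e \<in> B \<Longrightarrow> 0 \<le> f e \<and> f e \<le> M"
  obtains D :: "'a \<Rightarrow>\<^sub>L 'a" where "eigenbasis D B f"
proof -
  have on: "orthonormal B"
    using B by (rule orthonormal_basis_imp_orthonormal)
  have le: "(cmod (complex_of_real (f e) * cinner x e))\<^sup>2 \<le> M\<^sup>2 * (cmod (cinner x e))\<^sup>2" if "e \<in> B" for x e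
    using power_mono[of "f e" M 2] f[OF that] by (simp add: norm_mult power_mult_distrib mult_right_mono)
  have "\<exists>y. \<forall>e\<in>B. cinner y e = complex_of_real (f e) * cinner x e" for x
  proof -
    have "(\<Sum>e\<in>F. (cmod (complex_of_real (f e) * cinner x e))\<^sup>2) \<le> M\<^sup>2 * (norm x)\<^sup>2"
      if F: "finite F" "F \<subseteq> B" for F
    proof -
      have "(\<Sum>e\<in>F. (cmod (complex_of_real (f e) * cinner x e))\<^sup>2) \<le> (\<Sum>e\<in>F. M\<^sup>2 * (cmod (cinner x e))\<^sup>2)"
        using F by (intro sum_mono le) auto
      also have "\<dots> \<le> M\<^sup>2 * (norm x)\<^sup>2"
        unfolding sum_distrib_left[symmetric] by (intro mult_left_mono Bessel_inequality[OF on F]) simp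
      finally show ?thesis .
    qed
    from orthonormal_coefficients[OF on this] show ?thesis
      by metis
  qed
  then obtain d where d: "\<And>x e. e \<in> B \<Longrightarrow> cinner (d x) e = complex_of_real (f e) * cinner x e"
    by metis
  have "bounded_linear d"
  proof (rule bounded_linear_intro)
    show "d (x + y) = d x + d y" for x y
      by (rule orthonormal_basis_eqI[OF B]) (simp add: d cinner_add_left algebra_simps)
    show "d (r *\<^sub>R x) = r *\<^sub>R d x" for r x
      by (rule orthonormal_basis_eqI[OF B]) (simp add: d cinner_scaleR_left)
    show "norm (d x) \<le> norm x * \<bar>M\<bar>" for x
    proof -
      have "(norm (d x))\<^sup>2 \<le> M\<^sup>2 * (norm x)\<^sup>2"
        using le by (intro has_sum_mono[OF Parseval[OF B] has_sum_cmult_right[OF Parseval[OF B]]])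
          (simp add: d)
      then have "(norm (d x))\<^sup>2 \<le> (norm x * \<bar>M\<bar>)\<^sup>2"
        by (simp add: power_mult_distrib mult.commute)
      then show ?thesis
        by (rule power2_le_imp_le) simp
    qed
  qed
  then have D: "blinfun_apply (Blinfun d) = d"
    by (rule bounded_linear_Blinfun_apply)
  show thesis
  proof (rule that)
    have "d (c *\<^sub>C x) = c *\<^sub>C d x" for c x
      by (rule orthonormal_basis_eqI[OF B]) (simp add: d cinner_scaleC_left)
    then have "Blinfun d \<in> bounded_operators"
      by (simp add: bounded_operators_def D)
    moreover have "d e = f e *\<^sub>R e" if "e \<in> B" for e
      by (rule orthonormal_basis_eqI[OF B])
        (use that in \<open>auto simp: d cinner_scaleR_left cinner_orthonormal[OF on]\<close>)
    ultimately show "eigenbasis (Blinfun d) B f"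
      using B f by (simp add: eigenbasis_def D)
  qed
qed

text \<open>The adjoint value at \<open>y\<close> must have the coefficients
  \<open>cinner y (A e)\<close>. Their square-summability follows by duality: applying
  \<open>A\<close> to the vector \<open>z\<close> that has these as its coefficients on
  \<open>F\<close> gives \<open>norm z * norm z \<le> norm y * norm A * norm z\<close>.\<close>

lemma adjoint_exists:
  fixes B :: "'a::complex_hilbert_space set" and A :: "'a \<Rightarrow>\<^sub>L 'a"
  assumes B: "orthonormal_basis B" and A: "A \<in> bounded_operators"
  obtains A' where "A' \<in> bounded_operators"
    "\<And>x y. cinner (blinfun_apply A x) y = cinner x (blinfun_apply A' y)"
proof -
  have on: "orthonormal B"
    using B by (rule orthonormal_basis_imp_orthonormal)
  have "\<exists>z. \<forall>e\<in>B. cinner z e = cinner y (blinfun_apply A e)" for y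
  proof -
    have "(\<Sum>e\<in>F. (cmod (cinner y (blinfun_apply A e)))\<^sup>2) \<le> (norm y * norm A)\<^sup>2"
      if F: "finite F" "F \<subseteq> B" for F
    proof -
      define S where "S = (\<Sum>e\<in>F. (cmod (cinner y (blinfun_apply A e)))\<^sup>2)"
      define z where "z = (\<Sum>e\<in>F. cinner y (blinfun_apply A e) *\<^sub>C e)"
      have S: "0 \<le> S"
        by (simp add: S_def sum_nonneg)
      have z: "(norm z)\<^sup>2 = S"
        unfolding z_def S_def by (rule norm_orthonormal_sum[OF on F])
      have "cinner y (blinfun_apply A z) = complex_of_real S"
        by (simp add: z_def S_def blinfun.sum_right bounded_operators_scaleC[OF A] cinner_sum_right
            cinner_scaleC_right complex_norm_square mult.commute del: of_real_power)
      then have "S \<le> norm y * norm (blinfun_apply A z)"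
        using cmod_cinner_le[of y "blinfun_apply A z"] S by simp
      also have "\<dots> \<le> norm y * (norm A * norm z)"
        by (intro mult_left_mono norm_blinfun) simp
      finally have "S \<le> norm y * norm A * norm z"
        by (simp add: mult.assoc)
      then have "norm z * norm z \<le> norm y * norm A * norm z"
        using z by (simp add: power2_eq_square)
      then have "norm z \<le> norm y * norm A"
        by (cases "norm z = 0") (auto simp: mult_le_cancel_right)
      then show ?thesis
        using z power_mono[of "norm z" "norm y * norm A" 2] by (simp add: S_def)
    qed
    from orthonormal_coefficients[OF on this] show ?thesis
      by metis
  qed
  then obtain a where a: "\<And>y e. e \<in> B \<Longrightarrow> cinner (a y) e = cinner y (blinfun_apply A e)"
    by metis
  have adj: "cinner (blinfun_apply A x) y = cinner x (a y)" for x y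
  proof -
    have "((\<lambda>e. cinner x e * cinner (blinfun_apply A e) y) has_sum cinner (blinfun_apply A x) y) B"
      using has_sum_bounded_linear[OF bounded_linear_cinner_left bounded_operators_expansion[OF B A]]
      by (simp add: cinner_scaleC_left)
    moreover have "((\<lambda>e. cinner x e * cinner e (a y)) has_sum cinner x (a y)) B"
      using has_sum_bounded_linear[OF bounded_linear_cinner_left orthonormal_basis_expansion[OF B]]
      by (simp add: cinner_scaleC_left)
    moreover have "cinner (blinfun_apply A e) y = cinner e (a y)" if "e \<in> B" for e
      using a[OF that] by (subst (1 2) cinner_commute) simp
    ultimately show ?thesis
      by (simp cong: has_sum_cong add: has_sum_unique)
  qed
  have "bounded_linear a"
  proof (rule bounded_linear_intro)
    show "a (x + y) = a x + a y" for x y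
      by (rule orthonormal_basis_eqI[OF B]) (simp add: a cinner_add_left)
    show "a (r *\<^sub>R x) = r *\<^sub>R a x" for r x
      by (rule orthonormal_basis_eqI[OF B]) (simp add: a cinner_scaleR_left)
    show "norm (a y) \<le> norm y * norm A" for y
    proof -
      have "cmod (cinner (a y) (a y)) = (norm (a y))\<^sup>2"
        by (simp add: cinner_self del: of_real_power)
      then have "(norm (a y))\<^sup>2 = cmod (cinner (blinfun_apply A (a y)) y)"
        by (simp add: adj)
      also have "\<dots> \<le> norm A * norm (a y) * norm y"
        by (intro order.trans[OF cmod_cinner_le] mult_right_mono norm_blinfun) simp
      finally have "norm (a y) * norm (a y) \<le> (norm y * norm A) * norm (a y)"
        by (simp add: power2_eq_square mult_ac)
      then show ?thesis
        by (cases "norm (a y) = 0") (auto simp: mult_le_cancel_right)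
    qed
  qed
  then have D: "blinfun_apply (Blinfun a) = a"
    by (rule bounded_linear_Blinfun_apply)
  show thesis
  proof (rule that)
    have "a (c *\<^sub>C x) = c *\<^sub>C a x" for c x
      by (rule orthonormal_basis_eqI[OF B]) (simp add: a cinner_scaleC_left)
    then show "Blinfun a \<in> bounded_operators"
      by (simp add: bounded_operators_def D)
  qed (simp add: D adj)
qed

section \<open>Compact and positive operators\<close>

lemma compact_closure_subset:
  assumes "compact K" "U \<subseteq> (K :: 'a::t2_space set)"
  shows "compact (closure U)"
proof -
  have "closure U \<subseteq> K"
    using assms by (intro closure_minimal compact_imp_closed)
  then show ?thesis
    using compact_Int_closed[OF assms(1) closed_closure[of U]] by (simp add: Int_absorb1)
qed

lemma compact_opD:
  assumes "compact_op T"
  shows "T \<in> bounded_operators" "compact (closure (blinfun_apply T ` cball 0 1))"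
  using assms by (auto simp: compact_op_def)

lemma compact_op_add:
  assumes "compact_op S" "compact_op T"
  shows "compact_op (S + T)"
  unfolding compact_op_def
proof
  show "compact (closure (blinfun_apply (S + T) ` cball 0 1))"
  proof (rule compact_closure_subset)
    show "compact {x + y |x y. x \<in> closure (blinfun_apply S ` cball 0 1) \<and> y \<in> closure (blinfun_apply T ` cball 0 1)}"
      by (rule compact_sums[OF compact_opD(2)[OF assms(1)] compact_opD(2)[OF assms(2)]])
    show "blinfun_apply (S + T) ` cball 0 1
        \<subseteq> {x + y |x y. x \<in> closure (blinfun_apply S ` cball 0 1) \<and> y \<in> closure (blinfun_apply T ` cball 0 1)}"
    proof (rule image_subsetI)
      fix x :: 'a assume x: "x \<in> cball 0 1"
      have mem: "blinfun_apply R x \<in> closure (blinfun_apply R ` cball 0 1)" for R :: "'a \<Rightarrow>\<^sub>L 'a"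
        using subsetD[OF closure_subset imageI[OF x]] .
      show "blinfun_apply (S + T) x
          \<in> {x + y |x y. x \<in> closure (blinfun_apply S ` cball 0 1) \<and> y \<in> closure (blinfun_apply T ` cball 0 1)}"
        unfolding blinfun.add_left by (rule CollectI, intro exI conjI, rule refl) (rule mem)+
    qed
  qed
qed (use assms in \<open>intro bounded_operators_add compact_opD\<close>)

lemma compact_op_compose:
  assumes "S \<in> bounded_operators" "compact_op T"
  shows "compact_op (S o\<^sub>L T)"
  unfolding compact_op_def
proof
  show "compact (closure (blinfun_apply (S o\<^sub>L T) ` cball 0 1))"
  proof (rule compact_closure_subset)
    show "compact (blinfun_apply S ` closure (blinfun_apply T ` cball 0 1))"
      by (rule compact_continuous_image[OF linear_continuous_on[OF blinfun.bounded_linear_right]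
            compact_opD(2)[OF assms(2)]])
    show "blinfun_apply (S o\<^sub>L T) ` cball 0 1 \<subseteq> blinfun_apply S ` closure (blinfun_apply T ` cball 0 1)"
      using image_mono[OF closure_subset[of "blinfun_apply T ` cball 0 1"], of "blinfun_apply S"]
      by (simp add: image_image)
  qed
qed (use assms in \<open>intro bounded_operators_compose compact_opD(1)[OF assms(2)]\<close>)

lemma compact_op_uminus:
  assumes "compact_op T"
  shows "compact_op (- T)"
  unfolding compact_op_def
proof
  show "compact (closure (blinfun_apply (- T) ` cball 0 1))"
  proof (rule compact_closure_subset)
    show "compact ((\<lambda>x. - x) ` closure (blinfun_apply T ` cball 0 1))"
      by (rule compact_negations[OF compact_opD(2)[OF assms]])
    show "blinfun_apply (- T) ` cball 0 1 \<subseteq> (\<lambda>x. - x) ` closure (blinfun_apply T ` cball 0 1)"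
      using image_mono[OF closure_subset[of "blinfun_apply T ` cball 0 1"], of "\<lambda>x. - x"]
      by (simp add: image_image blinfun.minus_left)
  qed
qed (use assms in \<open>intro bounded_operators_uminus compact_opD\<close>)

lemma compact_op_diff:
  assumes "compact_op S" "compact_op T"
  shows "compact_op (S - T)"
  using compact_op_add[OF assms(1) compact_op_uminus[OF assms(2)]] by simp

lemma compact_op_zero: "compact_op (0 :: 'a::complex_hilbert_space \<Rightarrow>\<^sub>L 'a)"
  unfolding compact_op_def
proof
  have "norm (c *\<^sub>C (0 :: 'a)) = 0" for c
    by (simp only: norm_scaleC norm_zero mult_zero_right)
  then have "c *\<^sub>C 0 = (0 :: 'a)" for c
    by (simp only: norm_eq_zero)
  then show "(0 :: 'a \<Rightarrow>\<^sub>L 'a) \<in> bounded_operators"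
    by (simp add: bounded_operators_def)
qed (rule compact_closure_subset[of "{0}"], auto)

lemma compact_op_sum:
  assumes "\<And>i. i \<in> I \<Longrightarrow> compact_op (T i)"
  shows "compact_op (\<Sum>i\<in>I. T i)"
  using assms by (induction I rule: infinite_finite_induct) (auto intro: compact_op_add compact_op_zero)

section \<open>Positive operators and the spectral theorem\<close>

lemma positive_opD:
  assumes "positive_op T"
  shows "T \<in> bounded_operators" "0 \<le> Re (cinner (blinfun_apply T x) x)"
    "Im (cinner (blinfun_apply T x) x) = 0"
  using assms by (auto simp: positive_op_def complex_nonneg_Reals_iff)

text \<open>Polarization: a vanishing imaginary part of the form at
  \<open>x + \<i> *\<^sub>C y\<close> equates the real parts, and replacing \<open>y\<close> by
  \<open>\<i> *\<^sub>C y\<close> equates the imaginary parts.\<close>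

lemma positive_op_symmetric:
  assumes "positive_op T"
  shows "cinner (blinfun_apply T x) y = cinner x (blinfun_apply T y)"
proof -
  note T = bounded_operators_scaleC[OF positive_opD(1)[OF assms]]
  have Re: "Re (cinner (blinfun_apply T x) y) = Re (cinner x (blinfun_apply T y))" for x y
  proof -
    have "Im (cinner (blinfun_apply T (x + \<i> *\<^sub>C y)) (x + \<i> *\<^sub>C y)) = 0"
      "Im (cinner (blinfun_apply T x) x) = 0" "Im (cinner (blinfun_apply T y) y) = 0"
      by (rule positive_opD[OF assms])+
    then have "Re (cinner (blinfun_apply T y) x) = Re (cinner (blinfun_apply T x) y)"
      by (simp add: blinfun.add_right T cinner_add_left cinner_add_right cinner_scaleC_left cinner_scaleC_right)
    then show ?thesis
      by (subst (2) cinner_commute) simp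
  qed
  have "Im (cinner (blinfun_apply T x) y) = Im (cinner x (blinfun_apply T y))"
    using Re[of x "\<i> *\<^sub>C y"] by (simp add: T cinner_scaleC_right)
  with Re show ?thesis
    by (simp add: complex_eq_iff)
qed

lemma positive_op_symmetric_inner:
  assumes "positive_op T"
  shows "inner (blinfun_apply T x) y = inner x (blinfun_apply T y)"
  by (simp add: inner_eq_Re_cinner positive_op_symmetric[OF assms])

text \<open>Positivity of the quadratic form at \<open>x - P x / K\<close> bounds \<open>P x\<close> by the form itself.\<close>

lemma norm_le_quadratic_form:
  fixes P :: "'a::real_inner \<Rightarrow> 'a"
  assumes P: "bounded_linear P" "\<And>x y. inner (P x) y = inner x (P y)"
    and K: "0 < K" "\<And>x. norm (P x) \<le> K * norm x"
    and M: "subspace M" "\<And>x. x \<in> M \<Longrightarrow> P x \<in> M" "\<And>x. x \<in> M \<Longrightarrow> 0 \<le> inner (P x) x"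
    and x: "x \<in> M"
  shows "(norm (P x))\<^sup>2 \<le> K * inner (P x) x"
proof -
  interpret P: bounded_linear P by fact
  define y where "y = P x"
  have "0 \<le> inner (P (x - (1 / K) *\<^sub>R y)) (x - (1 / K) *\<^sub>R y)"
    unfolding y_def using M x by (intro M(3) subspace_diff subspace_scale)
  also have "\<dots> = inner y x - 2 / K * (norm y)\<^sup>2 + inner (P y) y / K\<^sup>2"
    unfolding power2_norm_eq_inner using P(2)[of y x]
    by (simp add: P.diff P.scaleR inner_diff y_def[symmetric] power2_eq_square inner_commute)
  also have "inner (P y) y / K\<^sup>2 \<le> (K * norm y * norm y) / K\<^sup>2"
    by (intro divide_right_mono order.trans[OF norm_cauchy_schwarz] mult_right_mono K) auto
  also have "\<dots> = (norm y)\<^sup>2 / K"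
    using K(1) by (simp add: power2_eq_square)
  finally have "0 \<le> inner y x - (norm y)\<^sup>2 / K"
    by simp
  then show ?thesis
    using K(1) by (simp add: y_def field_simps)
qed

text \<open>The supremum \<open>s\<close> of the form of \<open>T\<close> over the unit sphere of
  \<open>M\<close> is an eigenvalue. The form of \<open>P = s - T\<close> is nonnegative on
  \<open>M\<close>, so along a maximizing sequence \<open>norm_le_quadratic_form\<close> forces
  \<open>P (X n)\<close> to 0, and compactness of \<open>T\<close> provides a limit. That inequality
  is stated relative to a subspace because \<open>s\<close> bounds the form on \<open>M\<close>
  only.\<close>

lemma invariant_subspace_eigenvector:
  fixes T :: "'a::complex_hilbert_space \<Rightarrow>\<^sub>L 'a"
  assumes T: "compact_op T" "positive_op T"
    and M: "subspace M" "closed M" "\<And>x. x \<in> M \<Longrightarrow> blinfun_apply T x \<in> M" and x0: "x0 \<in> M" "x0 \<noteq> 0"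
  obtains y s where "y \<in> M" "norm y = 1" "0 \<le> s" "blinfun_apply T y = s *\<^sub>R y"
proof -
  define Q where "Q = (\<lambda>x. inner (blinfun_apply T x) x) ` {x \<in> M. norm x = 1}"
  define s where "s = Sup Q"
  have Qpos: "0 \<le> inner (blinfun_apply T x) x" for x
    using positive_opD(2)[OF T(2)] by (simp add: inner_eq_Re_cinner)
  have unit: "x0 /\<^sub>R norm x0 \<in> {x \<in> M. norm x = 1}"
    using x0 by (simp add: subspace_scale[OF M(1)])
  then have Qne: "Q \<noteq> {}"
    by (auto simp: Q_def)
  have "inner (blinfun_apply T x) x \<le> norm T" if "norm x = 1" for x
    using norm_cauchy_schwarz[of "blinfun_apply T x" x] norm_blinfun[of T x] that by simp
  then have Qbdd: "bdd_above Q"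
    by (auto simp: Q_def intro!: bdd_aboveI)
  have s0: "0 \<le> s"
    unfolding s_def using unit Qpos by (intro cSup_upper2[OF _ _ Qbdd]) (auto simp: Q_def)
  have upper: "inner (blinfun_apply T x) x \<le> s * (norm x)\<^sup>2" if "x \<in> M" for x
  proof (cases "x = 0")
    case False
    have "x /\<^sub>R norm x \<in> {x \<in> M. norm x = 1}"
      using False that by (simp add: subspace_scale[OF M(1)])
    then have "inner (blinfun_apply T (x /\<^sub>R norm x)) (x /\<^sub>R norm x) \<in> Q"
      unfolding Q_def by blast
    then have "inner (blinfun_apply T (x /\<^sub>R norm x)) (x /\<^sub>R norm x) \<le> s"
      unfolding s_def by (rule cSup_upper[OF _ Qbdd])
    then show ?thesis
      using False by (simp add: blinfun.scaleR_right field_simps power2_eq_square)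
  qed simp
  define P where "P = (\<lambda>x. s *\<^sub>R x - blinfun_apply T x)"
  \<comment> \<open>A bound for the norm of \<open>P\<close>; the summand 1 keeps it positive even
    if \<open>s\<close> and \<open>T\<close> vanish.\<close>
  define K where "K = s + norm T + 1"
  have K: "0 < K"
    using s0 by (simp add: K_def add_nonneg_pos)
  have P: "(norm (P x))\<^sup>2 \<le> K * (s * (norm x)\<^sup>2 - inner (blinfun_apply T x) x)" if "x \<in> M" for x
  proof -
    have "(norm (P x))\<^sup>2 \<le> K * inner (P x) x"
    proof (rule norm_le_quadratic_form[OF _ _ K _ M(1) _ _ that])
      show "bounded_linear P"
        unfolding P_def by (intro bounded_linear_sub bounded_linear_scaleR_right blinfun.bounded_linear_right)
      show "inner (P x) y = inner x (P y)" for x y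
        by (simp add: P_def inner_diff positive_op_symmetric_inner[OF T(2)])
      show "norm (P x) \<le> K * norm x" for x
      proof -
        have "norm (P x) \<le> norm (s *\<^sub>R x) + norm (blinfun_apply T x)"
          unfolding P_def by (rule norm_triangle_ineq4)
        also have "\<dots> \<le> s * norm x + norm T * norm x"
          using s0 norm_blinfun[of T x] by simp
        also have "\<dots> \<le> K * norm x"
          by (simp add: K_def algebra_simps)
        finally show ?thesis .
      qed
      show "P x \<in> M" if "x \<in> M" for x
        unfolding P_def using M that by (intro subspace_diff subspace_scale)
      show "0 \<le> inner (P x) x" if "x \<in> M" for x
        using upper[OF that] by (simp add: P_def inner_diff power2_norm_eq_inner)
    qed
    then show ?thesis
      by (simp add: P_def inner_diff power2_norm_eq_inner)
  qed
  show thesis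
  proof (cases "s = 0")
    case True
    \<comment> \<open>For \<open>s = 0\<close> the limit argument could end in the zero vector, but
      then \<open>P = - T\<close> vanishes on \<open>M\<close> and every unit vector of
      \<open>M\<close> serves.\<close>
    have "(norm (P x))\<^sup>2 \<le> 0" if "x \<in> M" for x
    proof -
      have "(norm (P x))\<^sup>2 \<le> - (K * inner (blinfun_apply T x) x)"
        using P[OF that] True by simp
      moreover have "0 \<le> K * inner (blinfun_apply T x) x"
        using Qpos[of x] K by simp
      ultimately show ?thesis
        by linarith
    qed
    then have "blinfun_apply T x = 0 *\<^sub>R x" if "x \<in> M" for x
      using that True by (simp add: P_def)
    with unit show thesis
      by (intro that[of "x0 /\<^sub>R norm x0" 0]) auto
  next
    case False
    then have s: "0 < s"
      using s0 by simp
    have "\<exists>x\<in>M. norm x = 1 \<and> s - 1 / Suc n < inner (blinfun_apply T x) x" for n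
      using less_cSup_iff[OF Qne Qbdd, of "s - 1 / Suc n"] unfolding s_def[symmetric]
      by (auto simp: Q_def)
    then obtain X where X: "\<And>n. X n \<in> M" "\<And>n. norm (X n) = 1"
      "\<And>n. s - 1 / Suc n < inner (blinfun_apply T (X n)) (X n)"
      by metis
    have "\<forall>n. blinfun_apply T (X n) \<in> closure (blinfun_apply T ` cball 0 1)"
    proof
      fix n
      have "blinfun_apply T (X n) \<in> blinfun_apply T ` cball 0 1"
        using X(2)[of n] by (intro imageI) simp
      then show "blinfun_apply T (X n) \<in> closure (blinfun_apply T ` cball 0 1)"
        by (rule subsetD[OF closure_subset])
    qed
    then obtain y r where r: "strict_mono (r :: nat \<Rightarrow> nat)"
      and Ty: "((\<lambda>n. blinfun_apply T (X n)) \<circ> r) \<longlonglongrightarrow> y"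
      using seq_compactE[OF compact_imp_seq_compact[OF compact_opD(2)[OF T(1)]]] by metis
    have "(\<lambda>n. (norm (P (X n)))\<^sup>2) \<longlonglongrightarrow> 0"
    proof (rule Lim_null_comparison)
      show "(\<lambda>n. K * (1 / Suc n)) \<longlonglongrightarrow> 0"
        using tendsto_mult_right_zero[OF LIMSEQ_inverse_real_of_nat, of K] by (simp add: inverse_eq_divide)
      have "(norm (P (X n)))\<^sup>2 \<le> K * (1 / Suc n)" for n
      proof -
        have "(norm (P (X n)))\<^sup>2 \<le> K * (s * (norm (X n))\<^sup>2 - inner (blinfun_apply T (X n)) (X n))"
          by (rule P[OF X(1)])
        also have "\<dots> \<le> K * (1 / Suc n)"
        proof (rule mult_left_mono)
          show "s * (norm (X n))\<^sup>2 - inner (blinfun_apply T (X n)) (X n) \<le> 1 / Suc n"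
            using less_imp_le[OF X(3)[of n]] unfolding X(2) by (simp only: power_one mult_1_right diff_le_eq add.commute)
        qed (use K in simp)
        finally show ?thesis .
      qed
      then show "\<forall>\<^sub>F n in sequentially. norm ((norm (P (X n)))\<^sup>2) \<le> K * (1 / Suc n)"
        by simp
    qed
    then have "(\<lambda>n. norm (P (X n))) \<longlonglongrightarrow> 0"
      using tendsto_real_sqrt[of "\<lambda>n. (norm (P (X n)))\<^sup>2" 0 sequentially] by simp
    then have "(\<lambda>n. P (X n)) \<longlonglongrightarrow> 0"
      by (rule tendsto_norm_zero_cancel)
    \<comment> \<open>\<open>s *\<^sub>R X n\<close> is the sum of \<open>P (X n)\<close>, which
      tends to 0, and \<open>T (X n)\<close>, which converges along \<open>r\<close>.\<close>
    from tendsto_add[OF LIMSEQ_subseq_LIMSEQ[OF this r] Ty]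
    have sX: "(\<lambda>n. s *\<^sub>R X (r n)) \<longlonglongrightarrow> y"
      by (simp add: P_def o_def)
    have "(\<lambda>n. s *\<^sub>R blinfun_apply T (X (r n))) \<longlonglongrightarrow> blinfun_apply T y"
      using blinfun.tendsto[OF tendsto_const sX, of T] by (simp add: blinfun.scaleR_right)
    moreover have "(\<lambda>n. s *\<^sub>R blinfun_apply T (X (r n))) \<longlonglongrightarrow> s *\<^sub>R y"
      using tendsto_scaleR[OF tendsto_const Ty, of s] by (simp add: o_def)
    ultimately have eigen: "blinfun_apply T y = s *\<^sub>R y"
      by (rule LIMSEQ_unique)
    \<comment> \<open>The limit is not zero: its norm is \<open>s\<close>, as the \<open>X n\<close>
      are unit vectors.\<close>
    have "(\<lambda>n. norm (s *\<^sub>R X (r n))) \<longlonglongrightarrow> norm y"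
      using sX by (rule tendsto_norm)
    then have ny: "norm y = s"
      using s by (simp add: X(2) LIMSEQ_const_iff)
    have "y \<in> M"
      using M(2) by (rule closed_sequentially[OF _ _ sX]) (simp add: X(1) subspace_scale[OF M(1)])
    then show thesis
      using s ny eigen
      by (intro that[of "y /\<^sub>R s" s]) (auto simp: subspace_scale[OF M(1)] blinfun.scaleR_right)
  qed
qed

lemma compact_positive_eigenbasis_exists:
  fixes T :: "'a::complex_hilbert_space \<Rightarrow>\<^sub>L 'a"
  assumes T: "compact_op T" "positive_op T"
  obtains B l where "eigenbasis T B l"
proof -
  define \<A> where "\<A> = {B. orthonormal B \<and> (\<forall>e\<in>B. \<exists>s\<ge>0. blinfun_apply T e = s *\<^sub>R e)}"
  have "\<exists>B\<in>\<A>. \<forall>X\<in>\<A>. B \<subseteq> X \<longrightarrow> X = B"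
  proof (rule Zorn_Lemma, rule ballI)
    fix C assume C: "C \<in> chains \<A>"
    then have mem: "B \<in> \<A>" if "B \<in> C" for B
      using that by (auto simp: chains_def)
    have "cinner e f = 0" if "e \<in> \<Union>C" "f \<in> \<Union>C" "e \<noteq> f" for e f
    proof -
      obtain B D where "B \<in> C" "D \<in> C" "e \<in> B" "f \<in> D"
        using \<open>e \<in> \<Union>C\<close> \<open>f \<in> \<Union>C\<close> by blast
      moreover have "B \<subseteq> D \<or> D \<subseteq> B"
        using C \<open>B \<in> C\<close> \<open>D \<in> C\<close> by (auto simp: chains_def chain_subset_def)
      ultimately obtain E where "E \<in> C" "e \<in> E" "f \<in> E"
        by blast
      then show ?thesis
        using mem[of E] \<open>e \<noteq> f\<close> by (auto simp: \<A>_def orthonormal_def)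
    qed
    moreover have "norm e = 1" "\<exists>s\<ge>0. blinfun_apply T e = s *\<^sub>R e" if "e \<in> \<Union>C" for e
      using that mem by (auto simp: \<A>_def orthonormal_def)
    ultimately show "\<Union>C \<in> \<A>"
      unfolding \<A>_def orthonormal_def by simp
  qed
  then obtain B where B: "B \<in> \<A>" and maximal: "\<And>X. X \<in> \<A> \<Longrightarrow> B \<subseteq> X \<Longrightarrow> X = B"
    by blast
  define l where "l e = (SOME s. 0 \<le> s \<and> blinfun_apply T e = s *\<^sub>R e)" for e
  have l: "0 \<le> l e \<and> blinfun_apply T e = l e *\<^sub>R e" if "e \<in> B" for e
  proof -
    have "\<exists>s. 0 \<le> s \<and> blinfun_apply T e = s *\<^sub>R e"
      using B that by (auto simp: \<A>_def)
    then show ?thesis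
      unfolding l_def by (rule someI_ex)
  qed
  have "x = 0" if x: "\<forall>e\<in>B. cinner x e = 0" for x
  proof (rule ccontr)
    assume "x \<noteq> 0"
    define M where "M = {x. \<forall>e\<in>B. cinner x e = 0}"
    have sub: "subspace M"
      by (auto simp: subspace_def M_def cinner_add_left cinner_scaleR_left)
    have cl: "closed M"
    proof -
      have "M = (\<Inter>e\<in>B. {x. cinner x e = 0})"
        by (auto simp: M_def)
      moreover have "closed {x. cinner x e = 0}" for e :: 'a
        by (rule closed_Collect_eq[OF linear_continuous_on[OF bounded_linear_cinner_left] continuous_on_const])
      ultimately show ?thesis
        by auto
    qed
    have inv: "blinfun_apply T z \<in> M" if "z \<in> M" for z
      using that l by (auto simp: M_def positive_op_symmetric[OF T(2)] cinner_scaleR_right)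
    have "x \<in> M"
      using x by (simp add: M_def)
    obtain y s where y: "y \<in> M" "norm y = 1" "0 \<le> s" "blinfun_apply T y = s *\<^sub>R y"
      by (rule invariant_subspace_eigenvector[OF T sub cl inv \<open>x \<in> M\<close> \<open>x \<noteq> 0\<close>])
    have "cinner y e = 0" "cinner e y = 0" if "e \<in> B" for e
      using y(1) that cinner_commute[of e y] by (auto simp: M_def)
    then have "insert y B \<in> \<A>"
      using B y by (auto simp: \<A>_def orthonormal_def)
    then have "y \<in> B"
      using maximal by blast
    then have "cinner y y = 0"
      using y(1) by (simp add: M_def)
    then show False
      using y(2) by (simp add: cinner_self)
  qed
  then have "eigenbasis T B l"
    using B l positive_opD(1)[OF T(2)] by (auto simp: eigenbasis_def orthonormal_basis_iff \<A>_def)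
  then show thesis
    by (rule that)
qed

text \<open>Diagonalizing the zero operator gives an orthonormal basis. This justifies the choice
  made in \<open>trace_op\<close>.\<close>

lemma orthonormal_basis_exists: "\<exists>B :: 'a::complex_hilbert_space set. orthonormal_basis B"
proof -
  have "positive_op (0 :: 'a \<Rightarrow>\<^sub>L 'a)"
    using compact_opD(1)[OF compact_op_zero] by (simp add: positive_op_def)
  with compact_op_zero obtain B and l :: "'a \<Rightarrow> real" where "eigenbasis (0 :: 'a \<Rightarrow>\<^sub>L 'a) B l"
    by (rule compact_positive_eigenbasis_exists)
  then show ?thesis
    using eigenbasisD(2) by blast
qed

section \<open>Schatten norms in terms of eigenvalues\<close>

text \<open>The description in \<open>adjoint_op\<close> is resolved: existence is
  \<open>adjoint_exists\<close>, and two adjoints have the same inner products with all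
  vectors.\<close>

lemma
  fixes A :: "'a::complex_hilbert_space \<Rightarrow>\<^sub>L 'a"
  assumes A: "A \<in> bounded_operators"
  shows adjoint_op_bounded: "adjoint_op A \<in> bounded_operators"
    and cinner_adjoint_op: "cinner (blinfun_apply A x) y = cinner x (blinfun_apply (adjoint_op A) y)"
proof -
  obtain B :: "'a set" where B: "orthonormal_basis B"
    using orthonormal_basis_exists by blast
  obtain A' where A': "A' \<in> bounded_operators"
    "\<And>x y. cinner (blinfun_apply A x) y = cinner x (blinfun_apply A' y)"
    using adjoint_exists[OF B A] by blast
  have "adjoint_op A = A'"
    unfolding adjoint_op_def
  proof (rule the_equality)
    fix C assume C: "C \<in> bounded_operators \<and>
      (\<forall>x y. cinner (blinfun_apply A x) y = cinner x (blinfun_apply C y))"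
    show "C = A'"
    proof (rule blinfun_eqI, rule orthonormal_basis_eqI[OF B])
      fix y e
      show "cinner (blinfun_apply C y) e = cinner (blinfun_apply A' y) e"
        using C A'(2) by (subst (1 2) cinner_commute) metis
    qed
  qed (use A' in auto)
  then show "adjoint_op A \<in> bounded_operators"
    "cinner (blinfun_apply A x) y = cinner x (blinfun_apply (adjoint_op A) y)"
    using A' by auto
qed

text \<open>Hence the diagonal of \<open>adjoint_op A o\<^sub>L A\<close> in any basis consists of
  the squared norms of the \<open>A e\<close>, and identities between sums of such operators can be
  stated with norms of vectors.\<close>

lemma cinner_adjoint_op_compose:
  assumes "A \<in> bounded_operators"
  shows "cinner (blinfun_apply (adjoint_op A o\<^sub>L A) x) x = complex_of_real ((norm (blinfun_apply A x))\<^sup>2)"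
  unfolding cinner_self[symmetric] blinfun_apply_blinfun_compose o_def cinner_adjoint_op[OF assms]
  by (subst cinner_commute)
    (simp only: cinner_adjoint_op[OF assms, symmetric] cinner_self complex_cnj_complex_of_real)

lemma compact_op_adjoint_op_compose:
  "compact_op A \<Longrightarrow> compact_op (adjoint_op A o\<^sub>L A)"
  by (intro compact_op_compose adjoint_op_bounded compact_opD)

lemma positive_op_adjoint_op_compose:
  assumes "A \<in> bounded_operators"
  shows "positive_op (adjoint_op A o\<^sub>L A)"
  using assms unfolding positive_op_def cinner_adjoint_op_compose[OF assms]
  by (auto intro: bounded_operators_compose adjoint_op_bounded simp del: of_real_power)

lemma adjoint_op_compose_eigenbasis_exists:
  assumes "compact_op A"
  obtains B l where "eigenbasis (adjoint_op A o\<^sub>L A) B l"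
  using compact_positive_eigenbasis_exists[OF compact_op_adjoint_op_compose[OF assms]
    positive_op_adjoint_op_compose[OF compact_opD(1)[OF assms]]] by blast

lemma eigenvalue_le_norm:
  assumes "eigenbasis T B l" "e \<in> B"
  shows "l e \<le> norm T"
  using norm_blinfun[of T e] eigenbasisD(4,5)[OF assms] orthonormal_norm[OF eigenbasisD(3)[OF assms(1)] assms(2)]
  by simp

text \<open>If \<open>T x = s\<^sup>2 x\<close> and \<open>S\<^sup>2 = T\<close>, then \<open>y = S x - s x\<close> satisfies \<open>S y = - s y\<close>.\<close>

lemma positive_sqrt_eigenvector:
  assumes S: "positive_op S" "S o\<^sub>L S = T" and x: "blinfun_apply T x = (s\<^sup>2) *\<^sub>R x" and s: "0 \<le> s"
  shows "blinfun_apply S x = s *\<^sub>R x"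
proof (cases "s = 0")
  case True
  have "cinner (blinfun_apply S x) (blinfun_apply S x) = cinner (blinfun_apply T x) x"
    unfolding S(2)[symmetric] by (simp add: positive_op_symmetric[OF S(1)])
  then show ?thesis
    using True x by (simp add: cinner_self)
next
  case False
  define y where "y = blinfun_apply S x - s *\<^sub>R x"
  have "blinfun_apply S (blinfun_apply S x) = (s\<^sup>2) *\<^sub>R x"
    using x unfolding S(2)[symmetric] by simp
  then have "blinfun_apply S y = - (s *\<^sub>R y)"
    by (simp add: y_def blinfun.diff_right blinfun.scaleR_right algebra_simps power2_eq_square)
  then have "Re (cinner (blinfun_apply S y) y) = - s * (norm y)\<^sup>2"
    by (simp add: cinner_minus_left cinner_scaleR_left cinner_self del: of_real_power)
  \<comment> \<open>Positivity of \<open>S\<close> excludes the negative eigenvalue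
    \<open>- s\<close>, so \<open>y\<close> vanishes.\<close>
  then have "s * (norm y)\<^sup>2 \<le> 0"
    using positive_opD(2)[OF S(1), of y] by simp
  then have "y = 0"
    using s False by (simp add: mult_le_0_iff)
  then show ?thesis
    by (simp add: y_def)
qed

text \<open>The diagonal operator with entries \<open>sqrt (l e)\<close> is one positive square
  root; any other acts in the same way on each \<open>e\<close> by
  \<open>positive_sqrt_eigenvector\<close>, which settles the definite description.\<close>

lemma abs_op_eigenbasis:
  assumes "eigenbasis (adjoint_op A o\<^sub>L A) B l"
  shows "eigenbasis (abs_op A) B (\<lambda>e. sqrt (l e))"
proof -
  define T where "T = adjoint_op A o\<^sub>L A"
  have T: "eigenbasis T B l"
    using assms by (simp add: T_def)
  have "0 \<le> sqrt (l e) \<and> sqrt (l e) \<le> sqrt (norm T)" if "e \<in> B" for e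
    using eigenvalue_le_norm[OF T that] eigenbasisD(4)[OF T that] by simp
  then obtain S where S: "eigenbasis S B (\<lambda>e. sqrt (l e))"
    using diagonal_operator_exists[OF eigenbasisD(2)[OF T]] by metis
  have SS: "S o\<^sub>L S = T"
  proof (rule bounded_operators_eqI[OF eigenbasisD(2)[OF T]])
    show "S o\<^sub>L S \<in> bounded_operators" "T \<in> bounded_operators"
      using S T by (auto intro: bounded_operators_compose eigenbasisD)
    show "blinfun_apply (S o\<^sub>L S) e = blinfun_apply T e" if "e \<in> B" for e
      using that by (simp add: eigenbasisD(5)[OF S] eigenbasisD(4,5)[OF T] blinfun.scaleR_right)
  qed
  have "abs_op A = S"
    unfolding abs_op_def T_def[symmetric]
  proof (rule the_equality)
    show "positive_op S \<and> S o\<^sub>L S = T"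
      using eigenbasis_imp_positive_op[OF S] SS by blast
    fix R assume R: "positive_op R \<and> R o\<^sub>L R = T"
    show "R = S"
    proof (rule bounded_operators_eqI[OF eigenbasisD(2)[OF T]])
      show "R \<in> bounded_operators" "S \<in> bounded_operators"
        using R positive_opD(1) eigenbasisD(1)[OF S] by auto
      fix e assume e: "e \<in> B"
      then have "blinfun_apply R e = sqrt (l e) *\<^sub>R e"
        using R eigenbasisD(4,5)[OF T e] by (intro positive_sqrt_eigenvector[of R T]) auto
      then show "blinfun_apply R e = blinfun_apply S e"
        using e by (simp add: eigenbasisD(5)[OF S])
    qed
  qed
  then show ?thesis
    using S by simp
qed

text \<open>If \<open>T x = t *\<^sub>R x\<close>, then \<open>cinner x e\<close> is 0 unless
  \<open>l e = t\<close>, so the diagonal operator with entries \<open>l e powr p\<close> acts on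
  all eigenvectors as required. Uniqueness holds because the condition fixes the values on
  \<open>B\<close>.\<close>

lemma op_powr_eigenbasis:
  assumes T: "eigenbasis T B l" and p: "0 < p"
  shows "eigenbasis (op_powr T p) B (\<lambda>e. l e powr p)"
proof -
  have "0 \<le> l e powr p \<and> l e powr p \<le> norm T powr p" if "e \<in> B" for e
    using eigenvalue_le_norm[OF T that] eigenbasisD(4)[OF T that] p by (simp add: powr_mono2)
  then obtain S where S: "eigenbasis S B (\<lambda>e. l e powr p)"
    using diagonal_operator_exists[OF eigenbasisD(2)[OF T]] by metis
  have "op_powr T p = S"
    unfolding op_powr_def
  proof (rule the_equality)
    show "S \<in> bounded_operators \<and> (\<forall>t\<ge>0. \<forall>x. blinfun_apply T x = t *\<^sub>R x \<longrightarrow>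
        blinfun_apply S x = (t powr p) *\<^sub>R x)"
    proof (intro conjI allI impI)
      fix t x assume x: "blinfun_apply T x = t *\<^sub>R x"
      show "blinfun_apply S x = (t powr p) *\<^sub>R x"
      proof (rule orthonormal_basis_eqI[OF eigenbasisD(2)[OF T]])
        fix e assume e: "e \<in> B"
        have "complex_of_real (l e) * cinner x e = complex_of_real t * cinner x e"
          using cinner_eigenbasis[OF T e, of x] by (simp only: x cinner_scaleR_left)
        then show "cinner (blinfun_apply S x) e = cinner ((t powr p) *\<^sub>R x) e"
          by (auto simp: cinner_eigenbasis[OF S e] cinner_scaleR_left)
      qed
    qed (rule eigenbasisD(1)[OF S])
    fix R assume R: "R \<in> bounded_operators \<and> (\<forall>t\<ge>0. \<forall>x. blinfun_apply T x = t *\<^sub>R x \<longrightarrow>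
        blinfun_apply R x = (t powr p) *\<^sub>R x)"
    then show "R = S"
      using eigenbasisD(4,5)[OF T]
      by (intro bounded_operators_eqI[OF eigenbasisD(2)[OF T] _ eigenbasisD(1)[OF S]])
        (auto simp: eigenbasisD(5)[OF S])
  qed
  then show ?thesis
    using S by simp
qed

text \<open>Expanding the form at each vector of the chosen basis gives a double sum of nonnegative
  terms; after the interchange the inner sum is Parseval's identity for the unit vector
  \<open>e\<close>.\<close>

lemma trace_op_eigenbasis:
  assumes T: "eigenbasis T B l"
  shows "trace_op T = (\<Sum>\<^sub>\<infinity>e\<in>B. ennreal (l e))"
proof -
  define F :: "'a set" where "F = (SOME B. orthonormal_basis B)"
  have F: "orthonormal_basis F"
    unfolding F_def using orthonormal_basis_exists by (rule someI_ex)
  have "trace_op T = (\<Sum>\<^sub>\<infinity>f\<in>F. \<Sum>\<^sub>\<infinity>e\<in>B. ennreal (l e * (cmod (cinner f e))\<^sup>2))"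
    unfolding trace_op_def F_def[symmetric]
    by (intro infsum_cong infsum_ennreal_has_sum[symmetric] quadratic_form_eigenbasis T)
      (simp add: eigenbasisD(4)[OF T])
  also have "\<dots> = (\<Sum>\<^sub>\<infinity>e\<in>B. \<Sum>\<^sub>\<infinity>f\<in>F. ennreal (l e * (cmod (cinner f e))\<^sup>2))"
    by (rule infsum_swap_ennreal)
  also have "\<dots> = (\<Sum>\<^sub>\<infinity>e\<in>B. ennreal (l e))"
  proof (rule infsum_cong)
    fix e assume e: "e \<in> B"
    have "(\<Sum>\<^sub>\<infinity>f\<in>F. ennreal (l e * (cmod (cinner f e))\<^sup>2)) = ennreal (l e) * (\<Sum>\<^sub>\<infinity>f\<in>F. ennreal ((cmod (cinner e f))\<^sup>2))"
      unfolding infsum_cmult_right_ennreal[symmetric]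
      by (intro infsum_cong) (simp add: ennreal_mult eigenbasisD(4)[OF T e] cmod_cinner_commute[of e])
    also have "\<dots> = ennreal (l e)"
      using orthonormal_norm[OF eigenbasisD(3)[OF T] e] by (simp add: Parseval_ennreal[OF F])
    finally show "(\<Sum>\<^sub>\<infinity>f\<in>F. ennreal (l e * (cmod (cinner f e))\<^sup>2)) = ennreal (l e)" .
  qed
  finally show ?thesis .
qed

text \<open>The exponent is halved because \<open>l\<close> lists the eigenvalues of the square of
  \<open>abs_op A\<close>.\<close>

lemma schatten_trace_eigenbasis:
  assumes A: "eigenbasis (adjoint_op A o\<^sub>L A) B l" and p: "0 < p"
  shows "trace_op (op_powr (abs_op A) p) = (\<Sum>\<^sub>\<infinity>e\<in>B. ennreal (l e powr (p / 2)))"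
  unfolding trace_op_eigenbasis[OF op_powr_eigenbasis[OF abs_op_eigenbasis[OF A] p]]
  by (intro infsum_cong) (simp add: powr_half_sqrt[symmetric] powr_powr eigenbasisD(4)[OF A])

section \<open>Trace inequalities\<close>

text \<open>Together with the column version: the squared moduli of the inner products between two
  orthonormal bases form a doubly stochastic matrix.\<close>

lemma infsum_cmod_cinner_row:
  assumes "orthonormal F" "orthonormal_basis B" "f \<in> F"
  shows "(\<Sum>\<^sub>\<infinity>e\<in>B. ennreal ((cmod (cinner f e))\<^sup>2)) = 1"
  by (simp add: Parseval_ennreal[OF assms(2)] orthonormal_norm[OF assms(1,3)])

lemma infsum_cmod_cinner_col:
  assumes "orthonormal_basis F" "orthonormal B" "e \<in> B"
  shows "(\<Sum>\<^sub>\<infinity>f\<in>F. ennreal ((cmod (cinner f e))\<^sup>2)) = 1"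
  using infsum_cmod_cinner_row[OF assms(2,1,3)] by (simp only: cmod_cinner_commute[of e])

lemma infsum_quadratic_form_eigenbasis:
  assumes "eigenbasis T B l"
  shows "(\<Sum>\<^sub>\<infinity>e\<in>B. ennreal (l e * (cmod (cinner x e))\<^sup>2)) = ennreal (Re (cinner (blinfun_apply T x) x))"
  by (rule infsum_ennreal_has_sum[OF quadratic_form_eigenbasis[OF assms]])
    (simp add: eigenbasisD(4)[OF assms])

lemma diagonal_powr_le_eigenvalues:
  assumes T: "eigenbasis T B l" and F: "orthonormal_basis F" and q: "1 \<le> q"
  shows "(\<Sum>\<^sub>\<infinity>f\<in>F. ennreal (Re (cinner (blinfun_apply T f) f) powr q)) \<le> (\<Sum>\<^sub>\<infinity>e\<in>B. ennreal (l e powr q))"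
proof (rule substochastic_powr_le[OF q, where w = "\<lambda>f e. (cmod (cinner f e))\<^sup>2"])
  show "0 \<le> Re (cinner (blinfun_apply T f) f)" for f
    by (rule positive_opD(2)[OF eigenbasis_imp_positive_op[OF T]])
qed (simp_all add: eigenbasisD(4)[OF T] infsum_quadratic_form_eigenbasis[OF T]
    infsum_cmod_cinner_row[OF orthonormal_basis_imp_orthonormal[OF F] eigenbasisD(2)[OF T]]
    infsum_cmod_cinner_col[OF F eigenbasisD(3)[OF T]])

lemma eigenvalues_powr_le_diagonal:
  assumes T: "eigenbasis T B l" and F: "orthonormal_basis F" and q: "0 < q" "q \<le> 1"
  shows "(\<Sum>\<^sub>\<infinity>e\<in>B. ennreal (l e powr q)) \<le> (\<Sum>\<^sub>\<infinity>f\<in>F. ennreal (Re (cinner (blinfun_apply T f) f) powr q))"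
proof (rule substochastic_powr_ge[OF q, where w = "\<lambda>f e. (cmod (cinner f e))\<^sup>2"])
  show "0 \<le> Re (cinner (blinfun_apply T f) f)" for f
    by (rule positive_opD(2)[OF eigenbasis_imp_positive_op[OF T]])
qed (simp_all add: eigenbasisD(4)[OF T] infsum_quadratic_form_eigenbasis[OF T]
    infsum_cmod_cinner_row[OF orthonormal_basis_imp_orthonormal[OF F] eigenbasisD(2)[OF T]]
    infsum_cmod_cinner_col[OF F eigenbasisD(3)[OF T]])

text \<open>Up to the factor \<open>l g\<close>, the sum is the quadratic form of the inverse of \<open>X\<close> at \<open>g\<close>
  (terms with \<open>m e = 0\<close> vanish since \<open>x / 0 = 0\<close>). It is tested on
  \<open>y = (\<Sum>e\<in>F. (cinner g e / m e) e)\<close>, for which \<open>cinner g y\<close> and \<open>cinner (X y) y\<close> both are the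
  sum \<open>S\<close> of the \<open>\<bar>cinner g e\<bar>\<^sup>2 / m e\<close>, so that \<open>l g S\<^sup>2 \<le> cinner (Y y) y \<le> S\<close>.\<close>

lemma eigenvalue_inverse_form_le_1:
  assumes Y: "eigenbasis Y G l" and g: "g \<in> G" and X: "eigenbasis X B m"
    and le: "\<And>y. Re (cinner (blinfun_apply Y y) y) \<le> Re (cinner (blinfun_apply X y) y)"
  shows "(\<Sum>\<^sub>\<infinity>e\<in>B. ennreal (l g * (cmod (cinner g e))\<^sup>2 / m e)) \<le> 1"
proof -
  note on = eigenbasisD(3)[OF X]
  have "(\<Sum>e\<in>F. l g * (cmod (cinner g e))\<^sup>2 / m e) \<le> 1" if F: "finite F" "F \<subseteq> B" for F
  proof -
    define a where "a e = cinner g e" for e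
    define y where "y = (\<Sum>e\<in>F. (a e / complex_of_real (m e)) *\<^sub>C e)"
    define S where "S = (\<Sum>e\<in>F. (cmod (a e))\<^sup>2 / m e)"
    have S: "0 \<le> S"
      unfolding S_def using F eigenbasisD(4)[OF X] by (intro sum_nonneg divide_nonneg_nonneg) auto
    have "cinner g y = (\<Sum>e\<in>F. complex_of_real ((cmod (a e))\<^sup>2 / m e))"
      unfolding y_def cinner_sum_right cinner_scaleC_right a_def[symmetric]
      by (intro sum.cong refl) (simp add: complex_norm_square del: of_real_power)
    then have gy: "cinner g y = complex_of_real S"
      by (simp add: S_def)
    have coeff: "cinner y e = (if e \<in> F then a e / complex_of_real (m e) else 0)" if "e \<in> B" for e
    proof -
      have "cinner y e = (\<Sum>f\<in>F. if f = e then a e / complex_of_real (m e) else 0)"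
        unfolding y_def cinner_sum_left cinner_scaleC_left
        using F that by (intro sum.cong refl) (auto simp: cinner_orthonormal[OF on])
      then show ?thesis
        using F(1) by simp
    qed
    have "((\<lambda>e. m e * (cmod (cinner y e))\<^sup>2) has_sum (\<Sum>e\<in>F. m e * (cmod (cinner y e))\<^sup>2)) B"
      using F by (intro has_sum_finite_neutralI[OF F]) (auto simp: coeff)
    with quadratic_form_eigenbasis[OF X, of y]
    have "Re (cinner (blinfun_apply X y) y) = (\<Sum>e\<in>F. m e * (cmod (cinner y e))\<^sup>2)"
      by (rule has_sum_unique)
    also have "\<dots> = S"
      unfolding S_def
    proof (intro sum.cong refl)
      fix e assume "e \<in> F"
      then have "cinner y e = a e / complex_of_real (m e)"
        using F coeff by auto
      then show "m e * (cmod (cinner y e))\<^sup>2 = (cmod (a e))\<^sup>2 / m e"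
        by (simp add: norm_divide power_divide) (simp add: power2_eq_square)
    qed
    finally have "Re (cinner (blinfun_apply X y) y) = S" .
    moreover have "(\<Sum>e\<in>{g}. l e * (cmod (cinner y e))\<^sup>2) \<le> Re (cinner (blinfun_apply Y y) y)"
      using g eigenbasisD(4)[OF Y] by (intro finite_sum_le_has_sum[OF quadratic_form_eigenbasis[OF Y]]) auto
    moreover have "cmod (cinner y g) = S"
      using S by (simp add: cmod_cinner_commute[of y g] gy)
    ultimately have "l g * S\<^sup>2 \<le> S"
      using le[of y] by simp
    then have "l g * S \<le> 1"
      using S by (cases "S = 0") (auto simp: power2_eq_square mult_le_cancel_right1 simp flip: mult.assoc)
    then show ?thesis
      by (simp add: S_def a_def sum_distrib_left)
  qed
  then have "(\<Sum>\<^sub>\<infinity>e\<in>B. ennreal (l g * (cmod (cinner g e))\<^sup>2 / m e)) \<le> ennreal 1"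
    using eigenbasisD(4)[OF Y g] eigenbasisD(4)[OF X]
    by (intro infsum_le_ennreal) (auto intro!: divide_nonneg_nonneg mult_nonneg_nonneg)
  then show ?thesis
    by simp
qed

section \<open>Spectra of the summands against the spectrum of the sum\<close>

context
  fixes I :: "'i set" and X :: "'i \<Rightarrow> 'a::complex_hilbert_space \<Rightarrow>\<^sub>L 'a" and G l B m
  assumes I: "finite I" and X: "\<And>i. i \<in> I \<Longrightarrow> eigenbasis (X i) (G i) (l i)"
    and sum: "eigenbasis (\<Sum>i\<in>I. X i) B m"
begin

lemma quadratic_form_sum:
  "Re (cinner (blinfun_apply (\<Sum>i\<in>I. X i) y) y) = (\<Sum>i\<in>I. Re (cinner (blinfun_apply (X i) y) y))"
  by (simp add: blinfun.sum_left cinner_sum_left)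

lemma quadratic_form_nonneg:
  "i \<in> I \<Longrightarrow> 0 \<le> Re (cinner (blinfun_apply (X i) y) y)"
  by (rule positive_opD(2)[OF eigenbasis_imp_positive_op[OF X]])

text \<open>\<open>m e\<close> is the form of the sum at the unit vector \<open>e\<close>, that is,
  the sum of the forms of the \<open>X i\<close>, each expanded in its own eigenbasis.\<close>

lemma eigenvalue_sum:
  assumes e: "e \<in> B"
  shows "(\<Sum>i\<in>I. \<Sum>\<^sub>\<infinity>g\<in>G i. ennreal (l i g * (cmod (cinner g e))\<^sup>2)) = ennreal (m e)"
proof -
  have "(\<Sum>i\<in>I. \<Sum>\<^sub>\<infinity>g\<in>G i. ennreal (l i g * (cmod (cinner g e))\<^sup>2))
      = (\<Sum>i\<in>I. ennreal (Re (cinner (blinfun_apply (X i) e) e)))"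
    using infsum_quadratic_form_eigenbasis[OF X, of _ e]
    by (intro sum.cong refl) (simp only: cmod_cinner_commute[of e])
  also have "\<dots> = ennreal (Re (cinner (blinfun_apply (\<Sum>i\<in>I. X i) e) e))"
    unfolding quadratic_form_sum by (rule sum_ennreal[OF quadratic_form_nonneg])
  also have "Re (cinner (blinfun_apply (\<Sum>i\<in>I. X i) e) e) = m e"
    using orthonormal_norm[OF eigenbasisD(3)[OF sum] e]
    unfolding eigenbasisD(5)[OF sum e] by (simp add: cinner_scaleR_left cinner_self)
  finally show ?thesis .
qed

text \<open>The weights below make the eigenvalues of the summands the image, under a substochastic
  matrix, of the eigenvalues of the sum.\<close>

lemma weights_row:
  assumes i: "i \<in> I" and g: "g \<in> G i"
  shows "(\<Sum>\<^sub>\<infinity>e\<in>B. ennreal (l i g * (cmod (cinner g e))\<^sup>2 / m e)) \<le> 1"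
proof (rule eigenvalue_inverse_form_le_1[OF X[OF i] g sum])
  show "Re (cinner (blinfun_apply (X i) y) y) \<le> Re (cinner (blinfun_apply (\<Sum>i\<in>I. X i) y) y)" for y
    unfolding quadratic_form_sum using I i quadratic_form_nonneg by (intro member_le_sum) auto
qed

lemma weights_nonneg:
  assumes "i \<in> I" "g \<in> G i" "e \<in> B"
  shows "0 \<le> l i g * (cmod (cinner g e))\<^sup>2 / m e"
  using eigenbasisD(4)[OF X[OF assms(1)] assms(2)] eigenbasisD(4)[OF sum assms(3)]
  by (intro divide_nonneg_nonneg mult_nonneg_nonneg) auto

text \<open>This is \<open>eigenvalue_sum\<close> divided by \<open>m e\<close>.\<close>

lemma weights_col:
  assumes e: "e \<in> B" "m e \<noteq> 0"
  shows "(\<Sum>\<^sub>\<infinity>(i, g)\<in>Sigma I G. ennreal (l i g * (cmod (cinner g e))\<^sup>2 / m e)) = 1"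
proof -
  have m: "0 < m e"
    using eigenbasisD(4)[OF sum e(1)] e(2) by simp
  have "(\<Sum>\<^sub>\<infinity>(i, g)\<in>Sigma I G. ennreal (l i g * (cmod (cinner g e))\<^sup>2 / m e))
      = (\<Sum>i\<in>I. \<Sum>\<^sub>\<infinity>g\<in>G i. ennreal (1 / m e) * ennreal (l i g * (cmod (cinner g e))\<^sup>2))"
    unfolding infsum_Sigma_finite_ennreal[OF I] prod.case
    using m eigenbasisD(4)[OF X] by (intro sum.cong infsum_cong refl) (simp flip: ennreal_mult)
  also have "\<dots> = ennreal (1 / m e) * ennreal (m e)"
    unfolding infsum_cmult_right_ennreal sum_distrib_left[symmetric] eigenvalue_sum[OF e(1)] ..
  also have "\<dots> = 1"
    using m by (simp flip: ennreal_mult)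
  finally show ?thesis .
qed

text \<open>Where \<open>m e = 0\<close> the division loses nothing: by
  \<open>eigenvalue_sum\<close> the numerator vanishes as well. Elsewhere \<open>m e\<close>
  cancels, and Parseval's identity for \<open>g\<close> remains.\<close>

lemma weights_image:
  assumes i: "i \<in> I" and g: "g \<in> G i"
  shows "ennreal (l i g) = (\<Sum>\<^sub>\<infinity>e\<in>B. ennreal (m e * (l i g * (cmod (cinner g e))\<^sup>2 / m e)))"
proof -
  have "m e * (l i g * (cmod (cinner g e))\<^sup>2 / m e) = l i g * (cmod (cinner g e))\<^sup>2" if e: "e \<in> B" for e
  proof (cases "m e = 0")
    case True
    have "ennreal (l i g * (cmod (cinner g e))\<^sup>2) \<le> (\<Sum>\<^sub>\<infinity>g\<in>G i. ennreal (l i g * (cmod (cinner g e))\<^sup>2))"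
      using finite_sum_le_infsum_ennreal[of "{g}" "G i"] g by simp
    also have "\<dots> \<le> (\<Sum>i\<in>I. \<Sum>\<^sub>\<infinity>g\<in>G i. ennreal (l i g * (cmod (cinner g e))\<^sup>2))"
      using I i by (intro member_le_sum) auto
    finally have "l i g * (cmod (cinner g e))\<^sup>2 \<le> 0"
      unfolding eigenvalue_sum[OF e] using True by (simp add: ennreal_eq_0_iff)
    moreover have "0 \<le> l i g * (cmod (cinner g e))\<^sup>2"
      using eigenbasisD(4)[OF X[OF i] g] by simp
    ultimately show ?thesis
      using True by simp
  qed simp
  then have "(\<Sum>\<^sub>\<infinity>e\<in>B. ennreal (m e * (l i g * (cmod (cinner g e))\<^sup>2 / m e)))
      = (\<Sum>\<^sub>\<infinity>e\<in>B. ennreal (l i g) * ennreal ((cmod (cinner g e))\<^sup>2))"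
    using eigenbasisD(4)[OF X[OF i] g] by (intro infsum_cong) (simp add: ennreal_mult)
  then show ?thesis
    by (simp add: infsum_cmult_right_ennreal
        infsum_cmod_cinner_row[OF eigenbasisD(3)[OF X[OF i]] eigenbasisD(2)[OF sum] g])
qed

text \<open>The spectra of all summands are concatenated over \<open>Sigma I G\<close>, so that one
  matrix treats them at once and its columns run over all \<open>X i\<close>.\<close>

lemma eigenvalues_powr_superadditive:
  assumes q: "1 \<le> q"
  shows "(\<Sum>i\<in>I. \<Sum>\<^sub>\<infinity>g\<in>G i. ennreal (l i g powr q)) \<le> (\<Sum>\<^sub>\<infinity>e\<in>B. ennreal (m e powr q))"
proof -
  have "(\<Sum>\<^sub>\<infinity>j\<in>Sigma I G. ennreal ((case j of (i, g) \<Rightarrow> l i g) powr q)) \<le> (\<Sum>\<^sub>\<infinity>e\<in>B. ennreal (m e powr q))"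
  proof (rule substochastic_powr_le[OF q,
        where w = "\<lambda>j e. case j of (i, g) \<Rightarrow> l i g * (cmod (cinner g e))\<^sup>2 / m e"])
    show "(\<Sum>\<^sub>\<infinity>j\<in>Sigma I G. ennreal (case j of (i, g) \<Rightarrow> l i g * (cmod (cinner g e))\<^sup>2 / m e)) \<le> 1"
      if "e \<in> B" "m e \<noteq> 0" for e
      using weights_col[OF that] by (simp add: case_prod_unfold)
    show "ennreal (case j of (i, g) \<Rightarrow> l i g)
        = (\<Sum>\<^sub>\<infinity>e\<in>B. ennreal (m e * (case j of (i, g) \<Rightarrow> l i g * (cmod (cinner g e))\<^sup>2 / m e)))"
      if "j \<in> Sigma I G" for j
      using that weights_image[of "fst j" "snd j"] by (simp only: case_prod_unfold mem_Sigma_iff) auto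
  qed (auto simp: eigenbasisD(4)[OF X] eigenbasisD(4)[OF sum] weights_nonneg weights_row)
  then show ?thesis
    by (simp add: infsum_Sigma_finite_ennreal[OF I])
qed

text \<open>The same matrix serves: on nonzero \<open>m e\<close> its columns sum to exactly 1,
  which also gives the lower bound that the concave case requires.\<close>

lemma eigenvalues_powr_subadditive:
  assumes q: "0 < q" "q \<le> 1"
  shows "(\<Sum>\<^sub>\<infinity>e\<in>B. ennreal (m e powr q)) \<le> (\<Sum>i\<in>I. \<Sum>\<^sub>\<infinity>g\<in>G i. ennreal (l i g powr q))"
proof -
  have "(\<Sum>\<^sub>\<infinity>e\<in>B. ennreal (m e powr q)) \<le> (\<Sum>\<^sub>\<infinity>j\<in>Sigma I G. ennreal ((case j of (i, g) \<Rightarrow> l i g) powr q))"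
  proof (rule substochastic_powr_ge[OF q,
        where w = "\<lambda>j e. case j of (i, g) \<Rightarrow> l i g * (cmod (cinner g e))\<^sup>2 / m e"])
    show "1 \<le> (\<Sum>\<^sub>\<infinity>j\<in>Sigma I G. ennreal (case j of (i, g) \<Rightarrow> l i g * (cmod (cinner g e))\<^sup>2 / m e))"
      if "e \<in> B" "m e \<noteq> 0" for e
      using weights_col[OF that] by (simp add: case_prod_unfold)
    show "ennreal (case j of (i, g) \<Rightarrow> l i g)
        = (\<Sum>\<^sub>\<infinity>e\<in>B. ennreal (m e * (case j of (i, g) \<Rightarrow> l i g * (cmod (cinner g e))\<^sup>2 / m e)))"
      if "j \<in> Sigma I G" for j
      using that weights_image[of "fst j" "snd j"] by (simp only: case_prod_unfold mem_Sigma_iff) auto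
  qed (auto simp: eigenbasisD(4)[OF X] eigenbasisD(4)[OF sum] weights_nonneg weights_row)
  then show ?thesis
    by (simp add: infsum_Sigma_finite_ennreal[OF I])
qed

end

section \<open>Schatten norm inequalities\<close>

lemma powr_le_imp_le:
  fixes x y q :: real
  assumes "0 < q" "0 \<le> y" "x powr q \<le> y powr q"
  shows "x \<le> y"
  using powr_less_mono2[of q y x] assms by force

text \<open>Jensen's inequality with equal weights, multiplied by the \<open>q\<close>-th power of
  the number of terms.\<close>

lemma power_mean_ge:
  fixes b :: "'i \<Rightarrow> real"
  assumes I: "finite I" "I \<noteq> {}" and q: "1 \<le> q" and b: "\<And>i. i \<in> I \<Longrightarrow> 0 \<le> b i"
  shows "(\<Sum>i\<in>I. b i) powr q \<le> real (card I) powr (q - 1) * (\<Sum>i\<in>I. b i powr q)"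
proof -
  define N where "N = real (card I)"
  have N: "0 < N"
    using I by (simp add: N_def card_gt_0_iff)
  have "(\<Sum>i\<in>I. (1 / N) *\<^sub>R b i) powr q \<le> (\<Sum>i\<in>I. 1 / N * b i powr q)"
    by (rule convex_on_sum[OF I convex_on_powr_nonneg[OF q]]) (use N b in \<open>auto simp: N_def\<close>)
  then have "N powr q * ((1 / N) * (\<Sum>i\<in>I. b i)) powr q \<le> N powr q * (1 / N * (\<Sum>i\<in>I. b i powr q))"
    by (intro mult_left_mono) (simp_all add: sum_distrib_left)
  moreover have "N powr q * ((1 / N) * (\<Sum>i\<in>I. b i)) powr q = (\<Sum>i\<in>I. b i) powr q"
    using N b by (simp add: powr_mult[symmetric] sum_nonneg)
  moreover have "N powr q * (1 / N * (\<Sum>i\<in>I. b i powr q)) = N powr (q - 1) * (\<Sum>i\<in>I. b i powr q)"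
    using N by (simp add: powr_diff)
  ultimately show ?thesis
    by (simp only: N_def)
qed

lemma power_mean_le:
  fixes b :: "'i \<Rightarrow> real"
  assumes I: "finite I" "I \<noteq> {}" and q: "0 < q" "q \<le> 1" and b: "\<And>i. i \<in> I \<Longrightarrow> 0 \<le> b i"
  shows "real (card I) powr (q - 1) * (\<Sum>i\<in>I. b i powr q) \<le> (\<Sum>i\<in>I. b i) powr q"
proof -
  define N where "N = real (card I)"
  have N: "0 < N"
    using I by (simp add: N_def card_gt_0_iff)
  have "(\<Sum>i\<in>I. 1 / N * b i powr q) \<le> (\<Sum>i\<in>I. (1 / N) *\<^sub>R b i) powr q"
    by (rule concave_on_sum[OF I concave_on_powr_nonneg[OF q]]) (use N b in \<open>auto simp: N_def\<close>)
  then have "N powr q * (1 / N * (\<Sum>i\<in>I. b i powr q)) \<le> N powr q * ((1 / N) * (\<Sum>i\<in>I. b i)) powr q"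
    by (intro mult_left_mono) (simp_all add: sum_distrib_left)
  moreover have "N powr q * ((1 / N) * (\<Sum>i\<in>I. b i)) powr q = (\<Sum>i\<in>I. b i) powr q"
    using N b by (simp add: powr_mult[symmetric] sum_nonneg)
  moreover have "N powr q * (1 / N * (\<Sum>i\<in>I. b i powr q)) = N powr (q - 1) * (\<Sum>i\<in>I. b i powr q)"
    using N by (simp add: powr_diff)
  ultimately show ?thesis
    by (simp only: N_def)
qed

text \<open>The real number \<open>a\<close> is the squared norm, equal to the
  \<open>q\<close>-(quasi)norm of the eigenvalues for \<open>q = p / 2\<close>; with it the final
  estimates become inequalities between real powers.\<close>

lemma schatten_norm_finiteE:
  assumes "schatten_norm p A < \<infinity>" "0 < p" "eigenbasis (adjoint_op A o\<^sub>L A) B l"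
  obtains a where "0 \<le> a" "(schatten_norm p A)\<^sup>2 = ennreal a"
    "(\<Sum>\<^sub>\<infinity>e\<in>B. ennreal (l e powr (p / 2))) = ennreal (a powr (p / 2))"
proof -
  define t where "t = (\<Sum>\<^sub>\<infinity>e\<in>B. ennreal (l e powr (p / 2)))"
  have norm: "schatten_norm p A = (if t = \<infinity> then \<infinity> else ennreal (enn2real t powr (1 / p)))"
    by (simp add: schatten_norm_def t_def schatten_trace_eigenbasis[OF assms(3,2)])
  then have t: "t \<noteq> \<infinity>"
    using assms(1) by auto
  show thesis
  proof (rule that)
    show "0 \<le> enn2real t powr (2 / p)"
      by simp
    show "(schatten_norm p A)\<^sup>2 = ennreal (enn2real t powr (2 / p))"
      using t by (simp add: norm power2_eq_square flip: ennreal_mult powr_add)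
    show "(\<Sum>\<^sub>\<infinity>e\<in>B. ennreal (l e powr (p / 2))) = ennreal ((enn2real t powr (2 / p)) powr (p / 2))"
      using t assms(2) by (simp add: powr_powr t_def[symmetric] less_top)
  qed
qed

lemma schatten_norm_finiteI:
  assumes "(\<Sum>\<^sub>\<infinity>e\<in>B. ennreal (l e powr (p / 2))) < \<infinity>" "0 < p" "eigenbasis (adjoint_op A o\<^sub>L A) B l"
  shows "schatten_norm p A < \<infinity>"
  using assms(1) by (auto simp: schatten_norm_def Let_def schatten_trace_eigenbasis[OF assms(3,2)])

text \<open>The hypothesis \<open>norms\<close> says, as an identity of quadratic forms, that the
  sum of the |C k|^2 is \<open>c\<close> times the sum of the |A i|^2. In the application
  \<open>K\<close> is the set of index pairs and \<open>c\<close> is twice the number of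
  indices.\<close>

context
  fixes K :: "'k set" and I :: "'i set" and C :: "'k \<Rightarrow> 'a::complex_hilbert_space \<Rightarrow>\<^sub>L 'a"
    and A :: "'i \<Rightarrow> 'a \<Rightarrow>\<^sub>L 'a" and c :: real
  assumes K: "finite K" and I: "finite I" "I \<noteq> {}" and c: "0 < c"
    and C: "\<And>k. k \<in> K \<Longrightarrow> compact_op (C k)" and A: "\<And>i. i \<in> I \<Longrightarrow> compact_op (A i)"
    and norms: "\<And>x. (\<Sum>k\<in>K. (norm (blinfun_apply (C k) x))\<^sup>2) = c * (\<Sum>i\<in>I. (norm (blinfun_apply (A i) x))\<^sup>2)"
begin

text \<open>The common basis of both estimates: it diagonalizes the sum of the |A i|^2, and in it
  the diagonals of the |C k|^2 add up exactly to \<open>c\<close> times the eigenvalues.\<close>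

lemma sum_eigenbasis_exists:
  obtains B m where "eigenbasis (\<Sum>i\<in>I. adjoint_op (A i) o\<^sub>L A i) B m"
    and "\<And>e. e \<in> B \<Longrightarrow> (\<Sum>k\<in>K. (norm (blinfun_apply (C k) e))\<^sup>2) = c * m e"
proof -
  let ?X = "\<Sum>i\<in>I. adjoint_op (A i) o\<^sub>L A i"
  have form: "cinner (blinfun_apply ?X x) x = complex_of_real (\<Sum>i\<in>I. (norm (blinfun_apply (A i) x))\<^sup>2)" for x
    using A by (simp add: blinfun.sum_left cinner_sum_left cinner_adjoint_op_compose[OF compact_opD(1)]
        del: blinfun_apply_blinfun_compose of_real_power)
  have cpt: "compact_op ?X"
    using A by (intro compact_op_sum compact_op_adjoint_op_compose)
  moreover have "positive_op ?X"
    unfolding positive_op_def form using compact_opD(1)[OF cpt]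
    by (simp add: complex_nonneg_Reals_iff sum_nonneg del: of_real_sum of_real_power)
  ultimately obtain B m where X: "eigenbasis ?X B m"
    by (rule compact_positive_eigenbasis_exists)
  show thesis
  proof (rule that[OF X])
    fix e assume e: "e \<in> B"
    have "complex_of_real (m e) = cinner (blinfun_apply ?X e) e"
      using orthonormal_norm[OF eigenbasisD(3)[OF X] e]
      by (simp only: eigenbasisD(5)[OF X e] cinner_scaleR_left cinner_self) simp
    then have "m e = (\<Sum>i\<in>I. (norm (blinfun_apply (A i) e))\<^sup>2)"
      unfolding form by (simp only: of_real_eq_iff)
    then show "(\<Sum>k\<in>K. (norm (blinfun_apply (C k) e))\<^sup>2) = c * m e"
      by (simp only: norms)
  qed
qed

text \<open>With \<open>a k\<close> and \<open>b i\<close> the squared norms of \<open>C k\<close>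
  and \<open>A i\<close>, superadditivity bounds the sum of the \<open>b i powr q\<close> by that of
  the \<open>m e powr q\<close>, and Minkowski's inequality bounds \<open>c powr q\<close> times the
  latter by the \<open>q\<close>-th power of the sum of the \<open>a k\<close>. The power mean
  inequality and a \<open>q\<close>-th root finish the proof. An infinite norm of some
  \<open>C k\<close> makes the claim trivial.\<close>

lemma schatten_norms_ge:
  assumes p: "2 \<le> p"
  shows "ennreal (c * real (card I) powr (2 / p - 1)) * (\<Sum>i\<in>I. (schatten_norm p (A i))\<^sup>2)
    \<le> (\<Sum>k\<in>K. (schatten_norm p (C k))\<^sup>2)"
proof (cases "\<exists>k\<in>K. schatten_norm p (C k) = \<infinity>")
  case True
  then obtain k where k: "k \<in> K" "schatten_norm p (C k) = \<infinity>"
    by blast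
  have "\<infinity> = (schatten_norm p (C k))\<^sup>2"
    by (simp add: k(2) power2_eq_square)
  also have "\<dots> \<le> (\<Sum>k\<in>K. (schatten_norm p (C k))\<^sup>2)"
    using K k(1) by (intro member_le_sum) auto
  finally show ?thesis
    by (simp add: top_unique)
next
  case False
  define q where "q = p / 2"
  have q: "1 \<le> q" "0 < p"
    using p by (auto simp: q_def)
  obtain B m where X: "eigenbasis (\<Sum>i\<in>I. adjoint_op (A i) o\<^sub>L A i) B m"
    and m: "\<And>e. e \<in> B \<Longrightarrow> (\<Sum>k\<in>K. (norm (blinfun_apply (C k) e))\<^sup>2) = c * m e"
    using sum_eigenbasis_exists by blast
  have "\<exists>G l. eigenbasis (adjoint_op (A i) o\<^sub>L A i) G l" if "i \<in> I" for i
    using adjoint_op_compose_eigenbasis_exists[OF A[OF that]] by blast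
  then obtain G l where G: "\<And>i. i \<in> I \<Longrightarrow> eigenbasis (adjoint_op (A i) o\<^sub>L A i) (G i) (l i)"
    by metis
  have "\<exists>a\<ge>0. (schatten_norm p (C k))\<^sup>2 = ennreal a \<and>
      (\<Sum>\<^sub>\<infinity>e\<in>B. ennreal ((norm (blinfun_apply (C k) e))\<^sup>2 powr q)) \<le> ennreal (a powr q)" if k: "k \<in> K" for k
  proof -
    obtain F r where F: "eigenbasis (adjoint_op (C k) o\<^sub>L C k) F r"
      by (rule adjoint_op_compose_eigenbasis_exists[OF C[OF k]])
    have "schatten_norm p (C k) < \<infinity>"
      using False k by (simp add: less_top)
    then obtain a where a: "0 \<le> a" "(schatten_norm p (C k))\<^sup>2 = ennreal a"
      "(\<Sum>\<^sub>\<infinity>e\<in>F. ennreal (r e powr q)) = ennreal (a powr q)"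
      unfolding q_def by (rule schatten_norm_finiteE[OF _ q(2) F])
    show ?thesis
      using a diagonal_powr_le_eigenvalues[OF F eigenbasisD(2)[OF X] q(1)]
      unfolding cinner_adjoint_op_compose[OF compact_opD(1)[OF C[OF k]]] Re_complex_of_real by auto
  qed
  then obtain a where a: "\<And>k. k \<in> K \<Longrightarrow> 0 \<le> a k" "\<And>k. k \<in> K \<Longrightarrow> (schatten_norm p (C k))\<^sup>2 = ennreal (a k)"
      "\<And>k. k \<in> K \<Longrightarrow> (\<Sum>\<^sub>\<infinity>e\<in>B. ennreal ((norm (blinfun_apply (C k) e))\<^sup>2 powr q)) \<le> ennreal (a k powr q)"
    by metis
  have "ennreal (c powr q) * (\<Sum>\<^sub>\<infinity>e\<in>B. ennreal (m e powr q)) = (\<Sum>\<^sub>\<infinity>e\<in>B. ennreal ((c * m e) powr q))"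
    unfolding infsum_cmult_right_ennreal[symmetric]
    using c eigenbasisD(4)[OF X] by (intro infsum_cong) (simp add: powr_mult flip: ennreal_mult)
  also have "\<dots> = (\<Sum>\<^sub>\<infinity>e\<in>B. ennreal ((\<Sum>k\<in>K. (norm (blinfun_apply (C k) e))\<^sup>2) powr q))"
    by (intro infsum_cong) (simp only: m)
  also have "\<dots> \<le> ennreal ((\<Sum>k\<in>K. a k) powr q)"
    by (rule Minkowski_powr_le[OF q(1) K _ a(1,3)]) simp_all
  finally have tX: "ennreal (c powr q) * (\<Sum>\<^sub>\<infinity>e\<in>B. ennreal (m e powr q)) \<le> ennreal ((\<Sum>k\<in>K. a k) powr q)" .
  have sup: "(\<Sum>i\<in>I. \<Sum>\<^sub>\<infinity>g\<in>G i. ennreal (l i g powr q)) \<le> (\<Sum>\<^sub>\<infinity>e\<in>B. ennreal (m e powr q))"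
    using I(1) G X q(1) by (rule eigenvalues_powr_superadditive)
  \<comment> \<open>The finite right-hand side of \<open>tX\<close> forces, through superadditivity,
    finite norms of the \<open>A i\<close>, as needed to obtain the real numbers
    \<open>b i\<close>.\<close>
  have "ennreal (c powr q) * (\<Sum>\<^sub>\<infinity>e\<in>B. ennreal (m e powr q)) < \<infinity>"
    using tX by (rule order.strict_trans1) simp
  then have "(\<Sum>\<^sub>\<infinity>e\<in>B. ennreal (m e powr q)) < \<infinity>"
    using c by (auto simp: ennreal_mult_less_top ennreal_eq_0_iff)
  then have fin: "(\<Sum>i\<in>I. \<Sum>\<^sub>\<infinity>g\<in>G i. ennreal (l i g powr q)) < \<infinity>"
    using sup by (rule order.strict_trans1[rotated])
  have "\<exists>b\<ge>0. (schatten_norm p (A i))\<^sup>2 = ennreal b \<and>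
      (\<Sum>\<^sub>\<infinity>g\<in>G i. ennreal (l i g powr q)) = ennreal (b powr q)" if i: "i \<in> I" for i
  proof -
    have "(\<Sum>\<^sub>\<infinity>g\<in>G i. ennreal (l i g powr q)) < \<infinity>"
      using fin I(1) i by (auto simp: less_top)
    then have "schatten_norm p (A i) < \<infinity>"
      unfolding q_def by (rule schatten_norm_finiteI[OF _ q(2) G[OF i]])
    then obtain b where "0 \<le> b" "(schatten_norm p (A i))\<^sup>2 = ennreal b"
      "(\<Sum>\<^sub>\<infinity>g\<in>G i. ennreal (l i g powr q)) = ennreal (b powr q)"
      unfolding q_def by (rule schatten_norm_finiteE[OF _ q(2) G[OF i]])
    then show ?thesis
      by auto
  qed
  then obtain b where b: "\<And>i. i \<in> I \<Longrightarrow> 0 \<le> b i" "\<And>i. i \<in> I \<Longrightarrow> (schatten_norm p (A i))\<^sup>2 = ennreal (b i)"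
      "\<And>i. i \<in> I \<Longrightarrow> (\<Sum>\<^sub>\<infinity>g\<in>G i. ennreal (l i g powr q)) = ennreal (b i powr q)"
    by metis
  define N where "N = real (card I)"
  have N: "0 < N"
    using I by (simp add: N_def card_gt_0_iff)
  have NN: "N powr (1 - q) * N powr (q - 1) = 1"
    using N by (simp flip: powr_add)
  have sums: "0 \<le> (\<Sum>k\<in>K. a k)" "0 \<le> (\<Sum>i\<in>I. b i)"
    using a(1) b(1) by (simp_all add: sum_nonneg)
  have "ennreal (c powr q * (\<Sum>i\<in>I. b i powr q)) = ennreal (c powr q) * (\<Sum>i\<in>I. ennreal (b i powr q))"
    by (simp add: ennreal_mult sum_nonneg)
  also have "\<dots> = ennreal (c powr q) * (\<Sum>i\<in>I. \<Sum>\<^sub>\<infinity>g\<in>G i. ennreal (l i g powr q))"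
    by (simp add: b(3))
  also have "\<dots> \<le> ennreal ((\<Sum>k\<in>K. a k) powr q)"
    by (rule order.trans[OF mult_left_mono[OF sup] tX]) simp
  finally have real: "c powr q * (\<Sum>i\<in>I. b i powr q) \<le> (\<Sum>k\<in>K. a k) powr q"
    by (simp add: ennreal_le_iff)
  \<comment> \<open>The exponent is chosen so that the \<open>q\<close>-th power of the factor is
    \<open>N powr (1 - q)\<close>, which cancels the factor of the power mean inequality.\<close>
  have "(c * N powr (1 / q - 1) * (\<Sum>i\<in>I. b i)) powr q = c powr q * N powr (1 - q) * (\<Sum>i\<in>I. b i) powr q"
    using c N q sums by (simp add: powr_mult powr_powr left_diff_distrib)
  also have "\<dots> \<le> c powr q * N powr (1 - q) * (N powr (q - 1) * (\<Sum>i\<in>I. b i powr q))"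
    unfolding N_def by (intro mult_left_mono power_mean_ge I q b(1)) auto
  also have "\<dots> = c powr q * (\<Sum>i\<in>I. b i powr q)"
    by (simp only: mult.assoc[symmetric]) (simp only: mult.assoc[of _ "N powr (1 - q)"] NN mult_1_right)
  also note real
  finally have "c * N powr (1 / q - 1) * (\<Sum>i\<in>I. b i) \<le> (\<Sum>k\<in>K. a k)"
    by (rule powr_le_imp_le[OF less_le_trans[OF zero_less_one q(1)] sums(1)])
  moreover have "1 / q = 2 / p"
    by (simp add: q_def)
  ultimately have "ennreal (c * N powr (2 / p - 1) * (\<Sum>i\<in>I. b i)) \<le> ennreal (\<Sum>k\<in>K. a k)"
    by (simp add: ennreal_leI)
  then show ?thesis
    using a(1) b(1) c sums by (simp add: a(2) b(2) N_def ennreal_mult)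
qed

text \<open>The chain of the preceding lemma with every step reversed. Now the norms of the
  \<open>C k\<close> have to be shown finite, starting from those of the \<open>A i\<close>.\<close>

lemma schatten_norms_le:
  assumes p: "0 < p" "p \<le> 2" and fin: "\<And>i. i \<in> I \<Longrightarrow> schatten_norm p (A i) < \<infinity>"
  shows "(\<Sum>k\<in>K. (schatten_norm p (C k))\<^sup>2)
    \<le> ennreal (c * real (card I) powr (2 / p - 1)) * (\<Sum>i\<in>I. (schatten_norm p (A i))\<^sup>2)"
proof -
  define q where "q = p / 2"
  have q: "0 < q" "q \<le> 1"
    using p by (auto simp: q_def)
  obtain B m where X: "eigenbasis (\<Sum>i\<in>I. adjoint_op (A i) o\<^sub>L A i) B m"
    and m: "\<And>e. e \<in> B \<Longrightarrow> (\<Sum>k\<in>K. (norm (blinfun_apply (C k) e))\<^sup>2) = c * m e"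
    using sum_eigenbasis_exists by blast
  have "\<exists>G l. eigenbasis (adjoint_op (A i) o\<^sub>L A i) G l" if "i \<in> I" for i
    using adjoint_op_compose_eigenbasis_exists[OF A[OF that]] by blast
  then obtain G l where G: "\<And>i. i \<in> I \<Longrightarrow> eigenbasis (adjoint_op (A i) o\<^sub>L A i) (G i) (l i)"
    by metis
  have "\<exists>b\<ge>0. (schatten_norm p (A i))\<^sup>2 = ennreal b \<and>
      (\<Sum>\<^sub>\<infinity>g\<in>G i. ennreal (l i g powr q)) = ennreal (b powr q)" if i: "i \<in> I" for i
  proof -
    obtain b where "0 \<le> b" "(schatten_norm p (A i))\<^sup>2 = ennreal b"
      "(\<Sum>\<^sub>\<infinity>g\<in>G i. ennreal (l i g powr q)) = ennreal (b powr q)"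
      unfolding q_def by (rule schatten_norm_finiteE[OF fin[OF i] p(1) G[OF i]])
    then show ?thesis
      by auto
  qed
  then obtain b where b: "\<And>i. i \<in> I \<Longrightarrow> 0 \<le> b i" "\<And>i. i \<in> I \<Longrightarrow> (schatten_norm p (A i))\<^sup>2 = ennreal (b i)"
      "\<And>i. i \<in> I \<Longrightarrow> (\<Sum>\<^sub>\<infinity>g\<in>G i. ennreal (l i g powr q)) = ennreal (b i powr q)"
    by metis
  have sub: "(\<Sum>\<^sub>\<infinity>e\<in>B. ennreal (m e powr q)) \<le> (\<Sum>i\<in>I. \<Sum>\<^sub>\<infinity>g\<in>G i. ennreal (l i g powr q))"
    using I(1) G X q by (rule eigenvalues_powr_subadditive)
  have "(\<Sum>\<^sub>\<infinity>e\<in>B. ennreal ((c * m e) powr q)) = ennreal (c powr q) * (\<Sum>\<^sub>\<infinity>e\<in>B. ennreal (m e powr q))"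
    unfolding infsum_cmult_right_ennreal[symmetric]
    using c eigenbasisD(4)[OF X] by (intro infsum_cong) (simp add: powr_mult flip: ennreal_mult)
  also have "\<dots> \<le> ennreal (c powr q) * (\<Sum>i\<in>I. \<Sum>\<^sub>\<infinity>g\<in>G i. ennreal (l i g powr q))"
    by (rule mult_left_mono[OF sub]) simp
  also have "\<dots> = ennreal (c powr q * (\<Sum>i\<in>I. b i powr q))"
    by (simp add: b(3) ennreal_mult sum_nonneg)
  finally have tX: "(\<Sum>\<^sub>\<infinity>e\<in>B. ennreal ((c * m e) powr q)) \<le> ennreal (c powr q * (\<Sum>i\<in>I. b i powr q))" .
  have "\<exists>a\<ge>0. (schatten_norm p (C k))\<^sup>2 = ennreal a \<and>
      ennreal (a powr q) \<le> (\<Sum>\<^sub>\<infinity>e\<in>B. ennreal ((norm (blinfun_apply (C k) e))\<^sup>2 powr q))" if k: "k \<in> K" for k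
  proof -
    obtain F r where F: "eigenbasis (adjoint_op (C k) o\<^sub>L C k) F r"
      by (rule adjoint_op_compose_eigenbasis_exists[OF C[OF k]])
    have le: "(\<Sum>\<^sub>\<infinity>e\<in>F. ennreal (r e powr q)) \<le> (\<Sum>\<^sub>\<infinity>e\<in>B. ennreal ((norm (blinfun_apply (C k) e))\<^sup>2 powr q))"
      using eigenvalues_powr_le_diagonal[OF F eigenbasisD(2)[OF X] q]
      unfolding cinner_adjoint_op_compose[OF compact_opD(1)[OF C[OF k]]] Re_complex_of_real .
    \<comment> \<open>Each diagonal entry of |C k|^2 is one nonnegative summand of
      \<open>c * m e\<close>, so the finite bound \<open>tX\<close> controls the eigenvalues of
      every single \<open>C k\<close>.\<close>
    also have "\<dots> \<le> (\<Sum>\<^sub>\<infinity>e\<in>B. ennreal ((c * m e) powr q))"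
    proof (rule infsum_mono_ennreal)
      fix e assume "e \<in> B"
      then have "(norm (blinfun_apply (C k) e))\<^sup>2 \<le> c * m e"
        unfolding m[OF \<open>e \<in> B\<close>, symmetric] using K k by (intro member_le_sum) auto
      then show "ennreal ((norm (blinfun_apply (C k) e))\<^sup>2 powr q) \<le> ennreal ((c * m e) powr q)"
        using q by (intro ennreal_leI powr_mono2) auto
    qed
    also note tX
    finally have "(\<Sum>\<^sub>\<infinity>e\<in>F. ennreal (r e powr q)) < \<infinity>"
      by (rule order.strict_trans1) simp
    then have "schatten_norm p (C k) < \<infinity>"
      unfolding q_def by (rule schatten_norm_finiteI[OF _ p(1) F])
    then obtain a where "0 \<le> a" "(schatten_norm p (C k))\<^sup>2 = ennreal a"
      "(\<Sum>\<^sub>\<infinity>e\<in>F. ennreal (r e powr q)) = ennreal (a powr q)"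
      unfolding q_def by (rule schatten_norm_finiteE[OF _ p(1) F])
    then show ?thesis
      using le by auto
  qed
  then obtain a where a: "\<And>k. k \<in> K \<Longrightarrow> 0 \<le> a k" "\<And>k. k \<in> K \<Longrightarrow> (schatten_norm p (C k))\<^sup>2 = ennreal (a k)"
      "\<And>k. k \<in> K \<Longrightarrow> ennreal (a k powr q) \<le> (\<Sum>\<^sub>\<infinity>e\<in>B. ennreal ((norm (blinfun_apply (C k) e))\<^sup>2 powr q))"
    by metis
  define N where "N = real (card I)"
  have N: "0 < N"
    using I by (simp add: N_def card_gt_0_iff)
  have NN: "N powr (1 - q) * N powr (q - 1) = 1"
    using N by (simp flip: powr_add)
  have sums: "0 \<le> (\<Sum>k\<in>K. a k)" "0 \<le> (\<Sum>i\<in>I. b i)"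
    using a(1) b(1) by (simp_all add: sum_nonneg)
  have "ennreal ((\<Sum>k\<in>K. a k) powr q) \<le> (\<Sum>\<^sub>\<infinity>e\<in>B. ennreal ((\<Sum>k\<in>K. (norm (blinfun_apply (C k) e))\<^sup>2) powr q))"
    by (rule Minkowski_powr_ge[OF q K _ a(1,3)]) simp_all
  also have "\<dots> = (\<Sum>\<^sub>\<infinity>e\<in>B. ennreal ((c * m e) powr q))"
    by (intro infsum_cong) (simp only: m)
  also note tX
  finally have real: "(\<Sum>k\<in>K. a k) powr q \<le> c powr q * (\<Sum>i\<in>I. b i powr q)"
    by (subst (asm) ennreal_le_iff) (auto intro!: mult_nonneg_nonneg sum_nonneg)
  also have "\<dots> = c powr q * N powr (1 - q) * (N powr (q - 1) * (\<Sum>i\<in>I. b i powr q))"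
    by (simp only: mult.assoc[symmetric]) (simp only: mult.assoc[of _ "N powr (1 - q)"] NN mult_1_right)
  also have "\<dots> \<le> c powr q * N powr (1 - q) * (\<Sum>i\<in>I. b i) powr q"
    unfolding N_def by (intro mult_left_mono power_mean_le I q b(1)) auto
  also have "\<dots> = (c * N powr (1 / q - 1) * (\<Sum>i\<in>I. b i)) powr q"
    using c N q sums by (simp add: powr_mult powr_powr left_diff_distrib)
  finally have "(\<Sum>k\<in>K. a k) \<le> c * N powr (1 / q - 1) * (\<Sum>i\<in>I. b i)"
    by (rule powr_le_imp_le[OF q(1) mult_nonneg_nonneg[OF mult_nonneg_nonneg[OF less_imp_le[OF c] powr_ge_zero] sums(2)]])
  moreover have "1 / q = 2 / p"
    by (simp add: q_def)
  ultimately have "ennreal (\<Sum>k\<in>K. a k) \<le> ennreal (c * N powr (2 / p - 1) * (\<Sum>i\<in>I. b i))"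
    by (simp add: ennreal_leI)
  then show ?thesis
    using a(1) b(1) c sums by (simp add: a(2) b(2) N_def ennreal_mult)
qed

end

text \<open>The cross terms add up to \<open>2 * s\<close> times the squared norm of the sum of the
  \<open>v i\<close>, which is 0; each squared norm occurs once for every partner in either
  position.\<close>

lemma sum_norm_add_scaleR_sq:
  fixes v :: "'i \<Rightarrow> 'a::real_inner"
  assumes "finite I" "(\<Sum>i\<in>I. v i) = 0" "s\<^sup>2 = 1"
  shows "(\<Sum>(i, j)\<in>I \<times> I. (norm (v i + s *\<^sub>R v j))\<^sup>2) = 2 * real (card I) * (\<Sum>i\<in>I. (norm (v i))\<^sup>2)"
proof -
  have "(norm (v i + s *\<^sub>R v j))\<^sup>2 = (norm (v i))\<^sup>2 + (norm (v j))\<^sup>2 + 2 * s * inner (v i) (v j)" for i j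
  proof -
    have "(norm (v i + s *\<^sub>R v j))\<^sup>2 = (norm (v i))\<^sup>2 + s\<^sup>2 * (norm (v j))\<^sup>2 + 2 * s * inner (v i) (v j)"
      unfolding power2_norm_eq_inner
      by (simp add: inner_add inner_commute power2_eq_square)
    then show ?thesis
      using assms(3) by simp
  qed
  then have "(\<Sum>(i, j)\<in>I \<times> I. (norm (v i + s *\<^sub>R v j))\<^sup>2)
      = (\<Sum>i\<in>I. \<Sum>j\<in>I. (norm (v i))\<^sup>2 + (norm (v j))\<^sup>2 + 2 * s * inner (v i) (v j))"
    by (simp add: sum.cartesian_product)
  also have "\<dots> = (\<Sum>i\<in>I. real (card I) * (norm (v i))\<^sup>2 + (\<Sum>j\<in>I. (norm (v j))\<^sup>2)
      + 2 * s * inner (v i) (\<Sum>j\<in>I. v j))"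
    by (simp add: sum.distrib inner_sum_right sum_distrib_left)
  also have "\<dots> = 2 * real (card I) * (\<Sum>i\<in>I. (norm (v i))\<^sup>2)"
    by (simp add: assms(2) sum.distrib sum_distrib_left mult.assoc)
  finally show ?thesis .
qed

text \<open>The scalar \<open>s\<close> treats both signs at once: the argument uses only that
  \<open>s\<^sup>2 = 1\<close> and that the operators \<open>A i + s *\<^sub>R A j\<close> are
  compact.\<close>

lemma sum_zero_schatten_norms:
  fixes A :: "'i \<Rightarrow> 'a::complex_hilbert_space \<Rightarrow>\<^sub>L 'a"
  assumes I: "finite I" "I \<noteq> {}" and A: "\<And>i. i \<in> I \<Longrightarrow> A i \<in> schatten_class p"
    and sum: "(\<Sum>i\<in>I. A i) = 0" and s: "s = 1 \<or> s = - 1"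
  shows "0 < p \<Longrightarrow> p \<le> 2 \<Longrightarrow> (\<Sum>i\<in>I. \<Sum>j\<in>I. (schatten_norm p (A i + s *\<^sub>R A j))\<^sup>2)
      \<le> ennreal (2 * real (card I) powr (2 / p)) * (\<Sum>i\<in>I. (schatten_norm p (A i))\<^sup>2)"
    and "2 \<le> p \<Longrightarrow> ennreal (2 * real (card I) powr (2 / p)) * (\<Sum>i\<in>I. (schatten_norm p (A i))\<^sup>2)
      \<le> (\<Sum>i\<in>I. \<Sum>j\<in>I. (schatten_norm p (A i + s *\<^sub>R A j))\<^sup>2)"
proof -
  define C where "C = (\<lambda>(i, j). A i + s *\<^sub>R A j)"
  have cpt: "compact_op (A i)" and fin: "schatten_norm p (A i) < \<infinity>" if "i \<in> I" for i
    using A[OF that] by (auto simp: schatten_class_def)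
  have C: "compact_op (C k)" if "k \<in> I \<times> I" for k
    using that s by (auto simp: C_def intro!: cpt compact_op_add compact_op_diff compact_op_uminus)
  have card: "0 < real (card I)"
    using I by (simp add: card_gt_0_iff)
  have norms: "(\<Sum>k\<in>I \<times> I. (norm (blinfun_apply (C k) x))\<^sup>2)
      = (2 * real (card I)) * (\<Sum>i\<in>I. (norm (blinfun_apply (A i) x))\<^sup>2)" for x
  proof -
    have "(\<Sum>i\<in>I. blinfun_apply (A i) x) = 0"
      using sum by (simp flip: blinfun.sum_left)
    moreover have "s\<^sup>2 = 1"
      using s by auto
    ultimately have "(\<Sum>(i, j)\<in>I \<times> I. (norm (blinfun_apply (A i) x + s *\<^sub>R blinfun_apply (A j) x))\<^sup>2)
        = (2 * real (card I)) * (\<Sum>i\<in>I. (norm (blinfun_apply (A i) x))\<^sup>2)"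
      by (rule sum_norm_add_scaleR_sq[OF I(1)])
    then show ?thesis
      by (simp add: C_def case_prod_unfold blinfun.add_left blinfun.scaleR_left)
  qed
  have sums: "(\<Sum>i\<in>I. \<Sum>j\<in>I. (schatten_norm p (A i + s *\<^sub>R A j))\<^sup>2) = (\<Sum>k\<in>I \<times> I. (schatten_norm p (C k))\<^sup>2)"
    by (simp add: C_def sum.cartesian_product case_prod_unfold)
  \<comment> \<open>The factor of the norm identity is merged with the factor of the power mean
    inequality.\<close>
  have const: "2 * real (card I) * real (card I) powr (2 / p - 1) = 2 * real (card I) powr (2 / p)"
    using card by (simp add: powr_diff)
  show "(\<Sum>i\<in>I. \<Sum>j\<in>I. (schatten_norm p (A i + s *\<^sub>R A j))\<^sup>2)
      \<le> ennreal (2 * real (card I) powr (2 / p)) * (\<Sum>i\<in>I. (schatten_norm p (A i))\<^sup>2)"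
    if "0 < p" "p \<le> 2"
    unfolding sums const[symmetric]
    by (rule schatten_norms_le[OF _ I _ C cpt norms that fin]) (use I card in auto)
  show "ennreal (2 * real (card I) powr (2 / p)) * (\<Sum>i\<in>I. (schatten_norm p (A i))\<^sup>2)
      \<le> (\<Sum>i\<in>I. \<Sum>j\<in>I. (schatten_norm p (A i + s *\<^sub>R A j))\<^sup>2)" if "2 \<le> p"
    unfolding sums const[symmetric]
    by (rule schatten_norms_ge[OF _ I _ C cpt norms that]) (use I card in auto)
qed

theorem corollary2p6:
  fixes A :: "nat \<Rightarrow> ('a::complex_hilbert_space \<Rightarrow>\<^sub>L 'a)"
    and n :: nat and p :: real
  assumes "separable_space (euclidean :: 'a topology)"
    and "n \<ge> 1" and "p > 0"
    and "\<And>i. i \<in> {1..n} \<Longrightarrow> A i \<in> schatten_class p"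
    and "(\<Sum>i=1..n. A i) = 0"
  shows
    "(p \<le> 2 \<longrightarrow>
        (\<Sum>i=1..n. \<Sum>j=1..n. (schatten_norm p (A i + A j))\<^sup>2)
          \<le> ennreal (2 * real n powr (2 / p)) * (\<Sum>i=1..n. (schatten_norm p (A i))\<^sup>2) \<and>
        (\<Sum>i=1..n. \<Sum>j=1..n. (schatten_norm p (A i - A j))\<^sup>2)
          \<le> ennreal (2 * real n powr (2 / p)) * (\<Sum>i=1..n. (schatten_norm p (A i))\<^sup>2)) \<and>
     (2 \<le> p \<longrightarrow>
        ennreal (2 * real n powr (2 / p)) * (\<Sum>i=1..n. (schatten_norm p (A i))\<^sup>2)
          \<le> (\<Sum>i=1..n. \<Sum>j=1..n. (schatten_norm p (A i + A j))\<^sup>2) \<and>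
        ennreal (2 * real n powr (2 / p)) * (\<Sum>i=1..n. (schatten_norm p (A i))\<^sup>2)
          \<le> (\<Sum>i=1..n. \<Sum>j=1..n. (schatten_norm p (A i - A j))\<^sup>2)) \<and>
     (p = 2 \<longrightarrow>
        (\<Sum>i=1..n. \<Sum>j=1..n. (schatten_norm 2 (A i - A j))\<^sup>2)
          = ennreal (2 * real n) * (\<Sum>i=1..n. (schatten_norm 2 (A i))\<^sup>2))"
proof -
  have I: "finite {1..n}" "{1..n} \<noteq> {}"
    using assms(2) by auto
  note ineqs = sum_zero_schatten_norms[where I = "{1..n}" and A = A and p = p, OF I assms(4,5)]
  note plus = ineqs[of 1] and minus = ineqs[of "- 1"]
  have minus_le: "(\<Sum>i=1..n. \<Sum>j=1..n. (schatten_norm p (A i - A j))\<^sup>2)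
      \<le> ennreal (2 * real n powr (2 / p)) * (\<Sum>i=1..n. (schatten_norm p (A i))\<^sup>2)" if "p \<le> 2"
    using minus(1) assms(3) that by simp
  have minus_ge: "ennreal (2 * real n powr (2 / p)) * (\<Sum>i=1..n. (schatten_norm p (A i))\<^sup>2)
      \<le> (\<Sum>i=1..n. \<Sum>j=1..n. (schatten_norm p (A i - A j))\<^sup>2)" if "2 \<le> p"
    using minus(2) that by simp
  show ?thesis
  proof (intro conjI impI)
    \<comment> \<open>Both estimates apply and share the constant, since the exponent
      \<open>2 / p\<close> is 1.\<close>
    assume "p = 2"
    then have "real n powr (2 / p) = real n"
      using assms(2) by simp
    with minus_le minus_ge \<open>p = 2\<close>
    show "(\<Sum>i=1..n. \<Sum>j=1..n. (schatten_norm 2 (A i - A j))\<^sup>2)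
        = ennreal (2 * real n) * (\<Sum>i=1..n. (schatten_norm 2 (A i))\<^sup>2)"
      by (intro antisym) simp_all
  qed (use plus minus_le minus_ge assms(3) in simp_all)
qed

end
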